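(* Let $m>0$, $g\ge 0$, let $\mathbb{I}=\mathrm{diag}(I_1,I_2,I_3)$ with $I_1,I_2,I_3>0$, and let $\boldsymbol{A}=(A_1,A_2,A_3)\in\mathbb{R}^3$ be constant. Consider the skater equations of motion with parameters $(m,g,\mathbb{I},\boldsymbol{A})$ (defined in the context). These equations are integrable due to the presence of constants of motion linear in the momenta $(p_v,p_{\Omega_1},p_{\Omega_2})$ (in the sense defined in the context) if and only if $A_1=0$. Moreover, when they exist, these integrals of motion can be computed explicitly in terms of elementary functions, i.e. the coefficient functions $\alpha(\theta),\beta(\theta),\gamma(\theta)$ of these integrals are elementary functions of $\theta$.
   Context: Notation. $\langle\cdot,\cdot\rangle$ is the Euclidean scalar product on $\mathbb{R}^3$, $\times$ is the cross product, and $\mathbf{E}_1=(1,0,0)$. All vectors are expressed in the frame of the skate, whose blade points along $\mathbf{E}_1$. The constants are: $m$ (mass), $g$ (gravitational acceleration; the case $g=0$ is allowed), $\mathbb{I}$ (moment of inertia about the center of mass), and $\boldsymbol{A}$ (position of the center of mass relative to the contact point, independent of time). Constrained variables. The state is $(\theta,\Omega_1,\Omega_2,v)$ with $\theta\in(-\pi/2,\pi/2)$ and $\Omega_1,\Omega_2,v\in\mathbb{R}$. Because of the constraints (constant pitch $\langle \mathbf{E}_1,\boldsymbol{\Gamma}\rangle=0$, continuous contact with the ice, which implies $\langle\boldsymbol{Y},\boldsymbol{\Gamma}\rangle=0$, and the non-holonomic skate condition $\langle\boldsymbol{Y},\mathbf{E}_1\times\boldsymbol{\Gamma}\rangle=0$),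 the vertical direction $\boldsymbol{\Gamma}$, the angular velocity $\boldsymbol{\Omega}$ and the linear velocity $\boldsymbol{Y}$ of the skate have the form $$\boldsymbol{\Gamma}=(0,\sin\theta,\cos\theta),\qquad \boldsymbol{\Omega}=\Omega_1\mathbf{E}_1+\Omega_2\boldsymbol{\Gamma},\qquad \boldsymbol{Y}=v\,\mathbf{E}_1 .$$ The linear and angular momenta are $$\boldsymbol{P}=m(\boldsymbol{Y}+\boldsymbol{\Omega}\times\boldsymbol{A}),\qquad \boldsymbol{\Pi}=\mathbb{I}\boldsymbol{\Omega}+\boldsymbol{A}\times\boldsymbol{P}.$$ Equations of motion. A solution of the skater equations of motion is a smooth curve $t\mapsto(\theta,\Omega_1,\Omega_2,v)$ for which there exist real-valued functions (Lagrange multipliers) $\kappa(t),\lambda(t),\mu(t)$ such that $$\dot{\boldsymbol{\Pi}}+\boldsymbol{\Omega}\times\boldsymbol{\Pi}-mg\,\boldsymbol{\Gamma}\times\boldsymbol{A}+\boldsymbol{Y}\times\boldsymbol{P}=\kappa\,(\mathbf{E}_1\times\boldsymbol{\Gamma}),$$ $$\dot{\boldsymbol{P}}+\boldsymbol{\Omega}\times\boldsymbol{P}=\lambda\,\boldsymbol{\Gamma}+\mu\,(\mathbf{E}_1\times\boldsymbol{\Gamma}),$$ $$\dot{\boldsymbol{\Gamma}}=-\boldsymbol{\Omega}\times\boldsymbol{\Gamma}\quad(\text{equivalently } \dot\theta=\Omega_1).$$ The energy $E=\tfrac12\langle\mathbb{I}\boldsymbol{\Omega},\boldsymbol{\Omega}\rangle+\tfrac12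 m\|\boldsymbol{Y}+\boldsymbol{\Omega}\times\boldsymbol{A}\|^2+mg\langle\boldsymbol{A},\boldsymbol{\Gamma}\rangle$ is always conserved. Momenta. The non-holonomic momenta are $$p_v=\langle\mathbf{E}_1,\boldsymbol{P}\rangle,\qquad p_{\Omega_1}=\langle\mathbf{E}_1,\boldsymbol{\Pi}\rangle,\qquad p_{\Omega_2}=\langle\boldsymbol{\Gamma},\boldsymbol{\Pi}\rangle .$$ Constants of motion linear in momenta. A constant of motion linear in momenta is a function $$C=\alpha(\theta)\,p_v+\beta(\theta)\,p_{\Omega_2}+\gamma(\theta)\,p_{\Omega_1},$$ with $\alpha,\beta,\gamma$ real-valued $C^1$ functions on $(-\pi/2,\pi/2)$, that is constant along every solution of the equations of motion. Integrability. The equations are called integrable due to the presence of constants of motion linear in momenta if there exist at least two constants of motion of this form whose coefficient triples $(\alpha,\beta,\gamma)$ are linearly independent over $\mathbb{R}$ (together with the energy $E$ these give three integrals on the four-dimensional space of $(v,\Omega_1,\Omega_2,\theta)$). *)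

theory Defs
  imports "HOL-Analysis.Analysis"
begin

section \<open>Elementary functions\<close>

text \<open>
  Real elementary functions on a set S. Powers with constant or variable exponents and roots of
  positive functions, \<^term>\<open>tan\<close>, hyperbolic functions, and (for arguments in the open interval
  from -1 to 1) arcsin, arccos and artanh are all compositions of the functions listed. Values
  outside S are irrelevant.
\<close>

inductive elementary_on :: "real set \<Rightarrow> (real \<Rightarrow> real) \<Rightarrow> bool" for S :: "real set" where
  const: "elementary_on S (\<lambda>x. c)"
| ident: "elementary_on S (\<lambda>x. x)"
| add: "elementary_on S f \<Longrightarrow> elementary_on S g \<Longrightarrow> elementary_on S (\<lambda>x. f x + g x)"
| diff: "elementary_on S f \<Longrightarrow> elementary_on S g \<Longrightarrow> elementary_on S (\<lambda>x. f x - g x)"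
| mult: "elementary_on S f \<Longrightarrow> elementary_on S g \<Longrightarrow> elementary_on S (\<lambda>x. f x * g x)"
| divide: "elementary_on S f \<Longrightarrow> elementary_on S g \<Longrightarrow> (\<And>x. x \<in> S \<Longrightarrow> g x \<noteq> 0) \<Longrightarrow>
    elementary_on S (\<lambda>x. f x / g x)"
| exp: "elementary_on S f \<Longrightarrow> elementary_on S (\<lambda>x. exp (f x))"
| ln: "elementary_on S f \<Longrightarrow> (\<And>x. x \<in> S \<Longrightarrow> f x > 0) \<Longrightarrow> elementary_on S (\<lambda>x. ln (f x))"
| sin: "elementary_on S f \<Longrightarrow> elementary_on S (\<lambda>x. sin (f x))"
| cos: "elementary_on S f \<Longrightarrow> elementary_on S (\<lambda>x. cos (f x))"
| arctan: "elementary_on S f \<Longrightarrow> elementary_on S (\<lambda>x. arctan (f x))"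
| cong: "elementary_on S f \<Longrightarrow> (\<And>x. x \<in> S \<Longrightarrow> g x = f x) \<Longrightarrow> elementary_on S g"

section \<open>The skater equations of motion\<close>

text \<open>For open T this is membership in the class of infinitely differentiable functions on T.\<close>

definition smooth_on :: "real set \<Rightarrow> (real \<Rightarrow> real) \<Rightarrow> bool" where
  "smooth_on T f \<longleftrightarrow> (\<forall>n. (deriv ^^ n) f differentiable_on T)"

definition lean_range :: "real set" where
  "lean_range = {- pi / 2<..<pi / 2}"

definition E1 :: "real^3" where
  "E1 = vector [1, 0, 0]"

definition Gam :: "real \<Rightarrow> real^3" where
  "Gam \<theta> = vector [0, sin \<theta>, cos \<theta>]"

definition ang_vel :: "real \<Rightarrow> real \<Rightarrow> real \<Rightarrow> real^3" where
  "ang_vel \<theta> \<Omega>\<^sub>1 \<Omega>\<^sub>2 = \<Omega>\<^sub>1 *\<^sub>R E1 + \<Omega>\<^sub>2 *\<^sub>R Gam \<theta>"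

definition lin_vel :: "real \<Rightarrow> real^3" where
  "lin_vel v = v *\<^sub>R E1"

context
  includes cross3_syntax
begin

definition lin_mom :: "real \<Rightarrow> real^3 \<Rightarrow> real \<Rightarrow> real \<Rightarrow> real \<Rightarrow> real \<Rightarrow> real^3" where
  "lin_mom m A \<theta> \<Omega>\<^sub>1 \<Omega>\<^sub>2 v = m *\<^sub>R (lin_vel v + ang_vel \<theta> \<Omega>\<^sub>1 \<Omega>\<^sub>2 \<times> A)"

definition ang_mom :: "real \<Rightarrow> real^3^3 \<Rightarrow> real^3 \<Rightarrow> real \<Rightarrow> real \<Rightarrow> real \<Rightarrow> real \<Rightarrow> real^3" where
  "ang_mom m \<I> A \<theta> \<Omega>\<^sub>1 \<Omega>\<^sub>2 v =
     \<I> *v ang_vel \<theta> \<Omega>\<^sub>1 \<Omega>\<^sub>2 + A \<times> lin_mom m A \<theta> \<Omega>\<^sub>1 \<Omega>\<^sub>2 v"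

text \<open>
  Solutions live on an arbitrary open time interval T, since the lean angle may leave
  \<^term>\<open>lean_range\<close> in finite time. The curves are smooth, so the derivatives
  \<^term>\<open>vector_derivative\<close> below exist.
\<close>

definition skater_solution ::
  "real \<Rightarrow> real \<Rightarrow> real^3^3 \<Rightarrow> real^3 \<Rightarrow> real set \<Rightarrow>
   (real \<Rightarrow> real) \<Rightarrow> (real \<Rightarrow> real) \<Rightarrow> (real \<Rightarrow> real) \<Rightarrow> (real \<Rightarrow> real) \<Rightarrow> bool" where
  "skater_solution m g \<I> A T \<theta> \<Omega>\<^sub>1 \<Omega>\<^sub>2 v \<longleftrightarrow>
     open T \<and> is_interval T \<and>
     smooth_on T \<theta> \<and> smooth_on T \<Omega>\<^sub>1 \<and> smooth_on T \<Omega>\<^sub>2 \<and> smooth_on T v \<and>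
     (\<forall>t\<in>T. \<theta> t \<in> lean_range) \<and>
     (let \<Gamma> = (\<lambda>t. Gam (\<theta> t));
          \<Omega> = (\<lambda>t. ang_vel (\<theta> t) (\<Omega>\<^sub>1 t) (\<Omega>\<^sub>2 t));
          Y = (\<lambda>t. lin_vel (v t));
          P = (\<lambda>t. lin_mom m A (\<theta> t) (\<Omega>\<^sub>1 t) (\<Omega>\<^sub>2 t) (v t));
          M = (\<lambda>t. ang_mom m \<I> A (\<theta> t) (\<Omega>\<^sub>1 t) (\<Omega>\<^sub>2 t) (v t))
      in \<exists>\<kappa> \<nu> \<mu> :: real \<Rightarrow> real. \<forall>t\<in>T.
           vector_derivative M (at t) + \<Omega> t \<times> M t - (m * g) *\<^sub>R (\<Gamma> t \<times> A) + Y t \<times> P t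
             = \<kappa> t *\<^sub>R (E1 \<times> \<Gamma> t) \<and>
           vector_derivative P (at t) + \<Omega> t \<times> P t = \<nu> t *\<^sub>R \<Gamma> t + \<mu> t *\<^sub>R (E1 \<times> \<Gamma> t) \<and>
           vector_derivative \<Gamma> (at t) = - (\<Omega> t \<times> \<Gamma> t))"

end

section \<open>Constants of motion linear in the non-holonomic momenta\<close>

definition p_v :: "real \<Rightarrow> real^3 \<Rightarrow> real \<Rightarrow> real \<Rightarrow> real \<Rightarrow> real \<Rightarrow> real" where
  "p_v m A \<theta> \<Omega>\<^sub>1 \<Omega>\<^sub>2 v = E1 \<bullet> lin_mom m A \<theta> \<Omega>\<^sub>1 \<Omega>\<^sub>2 v"

definition p_\<Omega>\<^sub>1 :: "real \<Rightarrow> real^3^3 \<Rightarrow> real^3 \<Rightarrow> real \<Rightarrow> real \<Rightarrow> real \<Rightarrow> real \<Rightarrow> real" where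
  "p_\<Omega>\<^sub>1 m \<I> A \<theta> \<Omega>\<^sub>1 \<Omega>\<^sub>2 v = E1 \<bullet> ang_mom m \<I> A \<theta> \<Omega>\<^sub>1 \<Omega>\<^sub>2 v"

definition p_\<Omega>\<^sub>2 :: "real \<Rightarrow> real^3^3 \<Rightarrow> real^3 \<Rightarrow> real \<Rightarrow> real \<Rightarrow> real \<Rightarrow> real \<Rightarrow> real" where
  "p_\<Omega>\<^sub>2 m \<I> A \<theta> \<Omega>\<^sub>1 \<Omega>\<^sub>2 v = Gam \<theta> \<bullet> ang_mom m \<I> A \<theta> \<Omega>\<^sub>1 \<Omega>\<^sub>2 v"

definition linear_constant_of_motion ::
  "real \<Rightarrow> real \<Rightarrow> real^3^3 \<Rightarrow> real^3 \<Rightarrow>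
   (real \<Rightarrow> real) \<Rightarrow> (real \<Rightarrow> real) \<Rightarrow> (real \<Rightarrow> real) \<Rightarrow> bool" where
  "linear_constant_of_motion m g \<I> A \<alpha> \<beta> \<gamma> \<longleftrightarrow>
     \<alpha> C1_differentiable_on lean_range \<and>
     \<beta> C1_differentiable_on lean_range \<and>
     \<gamma> C1_differentiable_on lean_range \<and>
     (\<forall>T \<theta> \<Omega>\<^sub>1 \<Omega>\<^sub>2 v. skater_solution m g \<I> A T \<theta> \<Omega>\<^sub>1 \<Omega>\<^sub>2 v \<longrightarrow>
       (\<lambda>t. \<alpha> (\<theta> t) * p_v m A (\<theta> t) (\<Omega>\<^sub>1 t) (\<Omega>\<^sub>2 t) (v t)
          + \<beta> (\<theta> t) * p_\<Omega>\<^sub>2 m \<I> A (\<theta> t) (\<Omega>\<^sub>1 t) (\<Omega>\<^sub>2 t) (v t)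
          + \<gamma> (\<theta> t) * p_\<Omega>\<^sub>1 m \<I> A (\<theta> t) (\<Omega>\<^sub>1 t) (\<Omega>\<^sub>2 t) (v t)) constant_on T)"

text \<open>Linear independence over the reals of two triples of functions on \<^term>\<open>lean_range\<close>.\<close>

definition independent_triples ::
  "(real \<Rightarrow> real) \<Rightarrow> (real \<Rightarrow> real) \<Rightarrow> (real \<Rightarrow> real) \<Rightarrow>
   (real \<Rightarrow> real) \<Rightarrow> (real \<Rightarrow> real) \<Rightarrow> (real \<Rightarrow> real) \<Rightarrow> bool" where
  "independent_triples \<alpha> \<beta> \<gamma> \<alpha>' \<beta>' \<gamma>' \<longleftrightarrow>
     (\<forall>a b :: real.
        (\<forall>\<theta>\<in>lean_range. a * \<alpha> \<theta> + b * \<alpha>' \<theta> = 0 \<and> a * \<beta> \<theta> + b * \<beta>' \<theta> = 0 \<and>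
                        a * \<gamma> \<theta> + b * \<gamma>' \<theta> = 0) \<longrightarrow>
        a = 0 \<and> b = 0)"

definition integrable_linear_in_momenta :: "real \<Rightarrow> real \<Rightarrow> real^3^3 \<Rightarrow> real^3 \<Rightarrow> bool" where
  "integrable_linear_in_momenta m g \<I> A \<longleftrightarrow>
     (\<exists>\<alpha> \<beta> \<gamma> \<alpha>' \<beta>' \<gamma>'.
        linear_constant_of_motion m g \<I> A \<alpha> \<beta> \<gamma> \<and>
        linear_constant_of_motion m g \<I> A \<alpha>' \<beta>' \<gamma>' \<and>
        independent_triples \<alpha> \<beta> \<gamma> \<alpha>' \<beta>' \<gamma>')"

end

theory Submission
  imports Defs
begin

text \<open>
  Projecting the equations of motion onto \<^term>\<open>E1\<close> and the vertical eliminates the multipliers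
  and gives the rates of the three momenta, quadratic in the velocities. A combination of the
  momenta is therefore constant iff a quadratic form in the velocities, with coefficients depending
  on the lean angle, vanishes identically: through every state there is a smooth solution, by
  Picard-Lindeloef. The coefficients of the form give linear differential equations for
  \<open>\<alpha>\<close>, \<open>\<beta>\<close>, \<open>\<gamma>\<close>. Write \<open>\<xi>\<close> and \<open>\<eta>\<close> for the horizontal
  and vertical coordinates of the center of mass transverse to the blade. If \<open>A\<^sub>1 \<noteq> 0\<close>, then
  \<open>\<alpha>\<close> and \<open>\<beta>\<close> are multiples of \<open>\<gamma>\<close> by fixed functions, and
  \<open>\<gamma> * sqrt (J - m * \<eta>\<^sup>2)\<close> is constant for \<open>J = I\<^sub>1 + m * (A\<^sub>2\<^sup>2 + A\<^sub>3\<^sup>2)\<close>,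
  so the solution space has dimension at most one. If \<open>A\<^sub>1 = 0\<close>, then \<open>\<alpha> + \<xi> * \<beta>\<close> is a constant \<open>k\<close>, and
  \<open>\<beta>' = k * m * \<eta> / R\<close> with \<open>R = I\<^sub>2 * sin\<^sup>2 + I\<^sub>3 * cos\<^sup>2\<close>, which
  integrates to arctangents or logarithms and leaves two free constants.
\<close>

section \<open>Flows of regular vector fields\<close>

text \<open>On a short time interval the integral operator maps curves in the ball to curves in the
  ball and halves distances, so Banach's theorem gives a fixed point, which is the solution.\<close>

lemma picard_lindeloef_forward:
  fixes F :: "'a::euclidean_space \<Rightarrow> 'a"
  assumes lip: "L-lipschitz_on (cball x0 r) F" and r: "r > 0"
  obtains h x where "h > 0" "x 0 = x0" "continuous_on {0..h} x" "x ` {0..h} \<subseteq> cball x0 r"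
    "\<And>t. t \<in> {0..h} \<Longrightarrow> (x has_vector_derivative F (x t)) (at t within {0..h})"
proof -
  let ?S = "cball x0 r"
  have contF: "continuous_on ?S F"
    using lip by (rule lipschitz_on_continuous_on)
  have L0: "L \<ge> 0"
    using lip by (rule lipschitz_on_nonneg)
  have "compact (F ` ?S)"
    using contF by (intro compact_continuous_image) auto
  then have "bounded (F ` ?S)"
    by (rule compact_imp_bounded)
  then obtain B where B: "B > 0" "\<And>x. x \<in> ?S \<Longrightarrow> norm (F x) \<le> B"
    unfolding bounded_pos by auto
  \<comment> \<open>The bound \<open>r / B\<close> keeps the iterates in the ball, and
    \<open>1 / (2 * L + 1)\<close> makes \<open>L * h\<close> at most 1/2; the summand 1 keeps the
    quotient meaningful when \<open>L = 0\<close>.\<close>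
  define h where "h = min (r / B) (1 / (2 * L + 1))"
  have h0: "h > 0"
    using B(1) L0 r by (auto simp: h_def)
  have "h \<le> r / B" "h \<le> 1 / (2 * L + 1)"
    by (auto simp: h_def)
  then have hB: "B * h \<le> r" and hL: "L * h \<le> 1 / 2"
    using B(1) L0 h0 by (auto simp: field_simps)
  \<comment> \<open>Clamping time to \<open>{0..h}\<close> lets curves be bounded continuous
    functions on the whole line, which form a complete metric space.\<close>
  define cl where "cl t = max 0 (min h t)" for t
  have cl: "0 \<le> cl t" "cl t \<le> h" for t
    using h0 by (auto simp: cl_def)
  have contcl: "continuous_on UNIV cl"
    unfolding cl_def by (intro continuous_intros)
  define \<Phi> where "\<Phi> f t = x0 + integral {0..cl t} (\<lambda>s. F (f s))" for f :: "real \<Rightarrow> 'a" and t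
  define X where "X = (PiC UNIV (\<lambda>_. ?S) :: (real \<Rightarrow>\<^sub>C 'a) set)"
  have XD: "apply_bcontfun f s \<in> ?S" if "f \<in> X" for f s
    using that by (auto simp: X_def mem_PiC_iff Pi_iff)
  have contFf: "continuous_on T (\<lambda>s. F (apply_bcontfun f s))" if "f \<in> X" for f T
    by (rule continuous_on_compose2[OF contF]) (use XD[OF that] in auto)
  have in_ball: "\<Phi> (apply_bcontfun f) t \<in> ?S" if f: "f \<in> X" for f t
  proof -
    have "norm (integral {0..cl t} (\<lambda>s. F (apply_bcontfun f s))) \<le> B * (cl t - 0)"
      using B(2) XD[OF f] cl contFf[OF f] by (intro integral_bound) auto
    also have "\<dots> \<le> r"
      using order_trans[OF mult_left_mono[OF cl(2)[of t], of B] hB] B(1) by simp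
    finally show ?thesis
      by (simp add: \<Phi>_def dist_norm)
  qed
  have contPhi: "continuous_on UNIV (\<Phi> (apply_bcontfun f))" if f: "f \<in> X" for f
  proof -
    have "continuous_on {0..h} (\<lambda>u. integral {0..u} (\<lambda>s. F (apply_bcontfun f s)))"
      by (intro indefinite_integral_continuous_1 integrable_continuous_real contFf[OF f])
    moreover have "range cl \<subseteq> {0..h}" using cl by auto
    ultimately show ?thesis
      unfolding \<Phi>_def by (intro continuous_intros continuous_on_compose2[OF _ contcl])
  qed
  have Phi_bcont: "\<Phi> (apply_bcontfun f) \<in> bcontfun" if f: "f \<in> X" for f
    unfolding bcontfun_def using contPhi[OF f] in_ball[OF f]
    by (auto intro!: bounded_subset[OF bounded_cball[of x0 r]])
  have ap: "apply_bcontfun (Bcontfun (\<Phi> (apply_bcontfun f))) = \<Phi> (apply_bcontfun f)" if "f \<in> X" for f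
    using Phi_bcont[OF that] by (rule Bcontfun_inverse)
  have "\<exists>!f. f \<in> X \<and> Bcontfun (\<Phi> (apply_bcontfun f)) = f"
  proof (rule Banach_fix)
    show "complete X"
      unfolding X_def complete_eq_closed by (intro closed_PiC) auto
    have "const_bcontfun x0 \<in> X"
      using r by (auto simp: X_def mem_PiC_iff const_bcontfun.rep_eq)
    then show "X \<noteq> {}" by blast
    show "(\<lambda>f. Bcontfun (\<Phi> (apply_bcontfun f))) ` X \<subseteq> X"
      using in_ball ap by (auto simp: X_def mem_PiC_iff Pi_iff)
    show "dist (Bcontfun (\<Phi> (apply_bcontfun f))) (Bcontfun (\<Phi> (apply_bcontfun g))) \<le> (1/2) * dist f g"
      if f: "f \<in> X" and g: "g \<in> X" for f g
    proof (rule dist_bound)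
      fix t
      have "dist (\<Phi> f t) (\<Phi> g t) = norm (integral {0..cl t} (\<lambda>s. F (f s) - F (g s)))"
        unfolding \<Phi>_def dist_norm
        by (subst integral_diff) (auto intro!: integrable_continuous_real contFf f g)
      also have "\<dots> \<le> (L * dist f g) * (cl t - 0)"
      proof (rule integral_bound)
        show "continuous_on {0..cl t} (\<lambda>s. F (f s) - F (g s))"
          by (intro continuous_intros contFf f g)
        fix s
        have "norm (F (f s) - F (g s)) \<le> L * dist (f s) (g s)"
          using lipschitz_onD[OF lip XD[OF f] XD[OF g]] by (simp add: dist_norm)
        also have "\<dots> \<le> L * dist f g"
          using L0 dist_bounded by (intro mult_left_mono)
        finally show "norm (F (f s) - F (g s)) \<le> L * dist f g" .
      qed (use cl in auto)
      also have "\<dots> \<le> (L * dist f g) * h"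
        using cl L0 by (intro mult_left_mono) auto
      also have "\<dots> = (L * h) * dist f g" by simp
      also have "\<dots> \<le> (1/2) * dist f g"
        using hL by (intro mult_right_mono) auto
      finally show "dist (Bcontfun (\<Phi> f) t) (Bcontfun (\<Phi> g) t) \<le> (1/2) * dist f g"
        using ap f g by simp
    qed
  qed auto
  then obtain x where x: "x \<in> X" "Bcontfun (\<Phi> (apply_bcontfun x)) = x" by blast
  then have fixed: "\<Phi> x = x" using ap by metis
  \<comment> \<open>Clamping is the identity on \<open>{0..h}\<close>, so the fixed point satisfies
    the integral equation there.\<close>
  have eq: "x t = x0 + integral {0..t} (\<lambda>s. F (x s))" if "t \<in> {0..h}" for t
    using that fun_cong[OF fixed, of t] by (simp add: \<Phi>_def cl_def)
  show thesis
  proof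
    show "x 0 = x0" using eq[of 0] h0 by simp
    show "(x has_vector_derivative F (x t)) (at t within {0..h})" if t: "t \<in> {0..h}" for t
    proof -
      have "((\<lambda>u. x0 + integral {0..u} (\<lambda>s. F (x s))) has_vector_derivative F (x t)) (at t within {0..h})"
        using has_vector_derivative_add[OF has_vector_derivative_const
            integral_has_vector_derivative[OF contFf[OF x(1)] t]] by simp
      then show ?thesis
        by (rule has_vector_derivative_transform[OF t, rotated]) (rule eq)
    qed
  qed (use h0 XD[OF x(1)] in auto)
qed

type_synonym state = "real \<times> real \<times> real \<times> real"

text \<open>
  Regular functions are Lipschitz on compact sets, which yields solutions of systems with regular
  right-hand sides, and closed under differentiation along such solutions, which yields smoothness.
\<close>

inductive regular :: "(state \<Rightarrow> real) \<Rightarrow> bool" where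
  const: "regular (\<lambda>p. c)"
| proj2: "regular (\<lambda>p. fst (snd p))"
| proj3: "regular (\<lambda>p. fst (snd (snd p)))"
| proj4: "regular (\<lambda>p. snd (snd (snd p)))"
| proj1: "regular fst"
| sin: "regular (\<lambda>p. sin (fst p))"
| cos: "regular (\<lambda>p. cos (fst p))"
| add: "regular f \<Longrightarrow> regular g \<Longrightarrow> regular (\<lambda>p. f p + g p)"
| mult: "regular f \<Longrightarrow> regular g \<Longrightarrow> regular (\<lambda>p. f p * g p)"
| inverse: "regular f \<Longrightarrow> (\<And>p. f p \<noteq> 0) \<Longrightarrow> regular (\<lambda>p. inverse (f p))"

section \<open>Closure and Lipschitz properties of regular functions\<close>

lemma regular_uminus: "regular f \<Longrightarrow> regular (\<lambda>p. - f p)"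
  using regular.mult[OF regular.const[of "-1"]] by simp

lemma regular_diff: "regular f \<Longrightarrow> regular g \<Longrightarrow> regular (\<lambda>p. f p - g p)"
  using regular.add[OF _ regular_uminus[of g]] by simp

lemma regular_divide: "regular f \<Longrightarrow> regular g \<Longrightarrow> (\<And>p. g p \<noteq> 0) \<Longrightarrow> regular (\<lambda>p. f p / g p)"
  using regular.mult[OF _ regular.inverse[of g]] by (simp add: field_class.field_divide_inverse)

lemma regular_power: "regular f \<Longrightarrow> regular (\<lambda>p. f p ^ n)"
  by (induction n) (auto intro: regular.intros)

lemmas regular_intros = regular.intros regular_uminus regular_diff regular_divide regular_power

lemma regular_continuous_on: "regular f \<Longrightarrow> continuous_on S f"
  by (induction rule: regular.induct) (auto intro!: continuous_intros)

lemma lipschitz_on_mult_bounded: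
  fixes f g :: "'a::metric_space \<Rightarrow> real"
  assumes "L-lipschitz_on K f" "M-lipschitz_on K g"
    and "\<And>x. x \<in> K \<Longrightarrow> \<bar>f x\<bar> \<le> B" "\<And>x. x \<in> K \<Longrightarrow> \<bar>g x\<bar> \<le> C" "0 \<le> B" "0 \<le> C"
  shows "(C * L + B * M)-lipschitz_on K (\<lambda>x. f x * g x)"
proof (rule lipschitz_onI)
  fix x y assume xy: "x \<in> K" "y \<in> K"
  have "\<bar>f x * g x - f y * g y\<bar> = \<bar>(f x - f y) * g x + f y * (g x - g y)\<bar>"
    by (simp add: algebra_simps)
  also have "\<dots> \<le> \<bar>f x - f y\<bar> * \<bar>g x\<bar> + \<bar>f y\<bar> * \<bar>g x - g y\<bar>"
    by (metis abs_mult abs_triangle_ineq)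
  also have "\<dots> \<le> (L * dist x y) * C + B * (M * dist x y)"
    using lipschitz_onD[OF assms(1) xy] lipschitz_onD[OF assms(2) xy] assms(3-) xy
    by (intro add_mono mult_mono) (auto simp: dist_real_def intro: order_trans[OF abs_ge_zero])
  finally show "dist (f x * g x) (f y * g y) \<le> (C * L + B * M) * dist x y"
    by (simp add: dist_real_def algebra_simps)
qed (use assms lipschitz_on_nonneg in \<open>auto intro!: add_nonneg_nonneg mult_nonneg_nonneg\<close>)

lemma lipschitz_on_inverse_bounded:
  fixes f :: "'a::metric_space \<Rightarrow> real"
  assumes "L-lipschitz_on K f" "\<And>x. x \<in> K \<Longrightarrow> f x \<noteq> 0" "\<And>x. x \<in> K \<Longrightarrow> \<bar>inverse (f x)\<bar> \<le> B" "0 \<le> B"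
  shows "(B * L * B)-lipschitz_on K (\<lambda>x. inverse (f x))"
proof (rule lipschitz_onI)
  fix x y assume xy: "x \<in> K" "y \<in> K"
  have "\<bar>inverse (f x) - inverse (f y)\<bar> = \<bar>inverse (f x)\<bar> * \<bar>f x - f y\<bar> * \<bar>inverse (f y)\<bar>"
    using assms(2)[OF xy(1)] assms(2)[OF xy(2)]
    by (simp add: inverse_diff_inverse abs_mult)
  also have "\<dots> \<le> B * (L * dist x y) * B"
    using lipschitz_onD[OF assms(1) xy] assms(3-) xy lipschitz_on_nonneg[OF assms(1)]
    by (intro mult_mono) (auto simp: dist_real_def)
  finally show "dist (inverse (f x)) (inverse (f y)) \<le> B * L * B * dist x y"
    by (simp add: dist_real_def algebra_simps)
qed (use assms lipschitz_on_nonneg in \<open>auto intro!: mult_nonneg_nonneg\<close>)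

lemma compact_bounded_real:
  fixes f :: "'a::metric_space \<Rightarrow> real"
  assumes "compact K" "continuous_on K f"
  obtains B where "B \<ge> 0" "\<And>x. x \<in> K \<Longrightarrow> \<bar>f x\<bar> \<le> B"
proof -
  have "bounded (f ` K)"
    using assms by (intro compact_imp_bounded compact_continuous_image)
  then show thesis
    using that unfolding bounded_pos by (auto intro: less_imp_le)
qed

lemma lipschitz_on_sin: "1-lipschitz_on UNIV (sin :: real \<Rightarrow> real)"
proof (rule lipschitz_onI)
  show "dist (sin x) (sin y) \<le> 1 * dist x y" for x y :: real
    using field_differentiable_bound[of UNIV sin cos 1 x y]
    by (auto simp: dist_norm intro!: derivative_eq_intros)
qed simp

lemma lipschitz_on_cos: "1-lipschitz_on UNIV (cos :: real \<Rightarrow> real)"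
proof (rule lipschitz_onI)
  show "dist (cos x) (cos y) \<le> 1 * dist x y" for x y :: real
    using field_differentiable_bound[of UNIV cos "\<lambda>x. - sin x" 1 x y]
    by (auto simp: dist_norm intro!: derivative_eq_intros)
qed simp

text \<open>Induction over the construction. Products and inverses are controlled by bounds, which
  continuity on the compact set supplies; sine and cosine are Lipschitz on the whole line.\<close>

lemma regular_lipschitz:
  assumes "regular f" "compact K"
  shows "\<exists>L. L-lipschitz_on K f"
  using assms(1)
proof induction
  case (const c)
  show ?case by (auto intro!: exI[of _ 0] lipschitz_onI)
next
  case proj1
  show ?case by (rule exI[of _ 1], rule lipschitz_onI) (use dist_fst_le in auto)
next
  case proj2
  show ?case
    by (rule exI[of _ 1], rule lipschitz_onI) (auto intro: order_trans[OF dist_fst_le dist_snd_le])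
next
  case proj3
  show ?case
    by (rule exI[of _ 1], rule lipschitz_onI)
      (auto intro: order_trans[OF dist_fst_le order_trans[OF dist_snd_le dist_snd_le]])
next
  case proj4
  show ?case
    by (rule exI[of _ 1], rule lipschitz_onI)
      (auto intro: order_trans[OF dist_snd_le order_trans[OF dist_snd_le dist_snd_le]])
next
  case sin
  have "dist (sin (fst p)) (sin (fst q)) \<le> dist p q" for p q :: state
    using lipschitz_onD[OF lipschitz_on_sin, of "fst p" "fst q"] dist_fst_le[of p q] by simp
  then show ?case by (auto intro!: exI[of _ 1] lipschitz_onI)
next
  case cos
  have "dist (cos (fst p)) (cos (fst q)) \<le> dist p q" for p q :: state
    using lipschitz_onD[OF lipschitz_on_cos, of "fst p" "fst q"] dist_fst_le[of p q] by simp
  then show ?case by (auto intro!: exI[of _ 1] lipschitz_onI)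
next
  case (add f g)
  then show ?case using lipschitz_on_add by blast
next
  case (mult f g)
  obtain B where "B \<ge> 0" "\<And>x. x \<in> K \<Longrightarrow> \<bar>f x\<bar> \<le> B"
    by (rule compact_bounded_real[OF assms(2) regular_continuous_on[OF mult.hyps(1)]]) blast
  moreover obtain C where "C \<ge> 0" "\<And>x. x \<in> K \<Longrightarrow> \<bar>g x\<bar> \<le> C"
    by (rule compact_bounded_real[OF assms(2) regular_continuous_on[OF mult.hyps(2)]]) blast
  moreover obtain L M where "L-lipschitz_on K f" "M-lipschitz_on K g"
    using mult.IH by blast
  ultimately show ?case
    by (intro exI[of _ "C * L + B * M"] lipschitz_on_mult_bounded) auto
next
  case (inverse f)
  obtain B where "B \<ge> 0" "\<And>x. x \<in> K \<Longrightarrow> \<bar>inverse (f x)\<bar> \<le> B"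
    by (rule compact_bounded_real[OF assms(2) regular_continuous_on[OF regular.inverse[OF inverse.hyps]]]) blast
  moreover obtain L where "L-lipschitz_on K f"
    using inverse.IH by blast
  ultimately show ?case
    using inverse.hyps(2) by (intro exI[of _ "B * L * B"] lipschitz_on_inverse_bounded) auto
qed

section \<open>Differentiation along flows\<close>

lemma has_vector_derivative_components:
  assumes "(x has_vector_derivative (a, b, c, d)) (at t)"
  shows "((\<lambda>s. fst (x s)) has_real_derivative a) (at t)"
    "((\<lambda>s. fst (snd (x s))) has_real_derivative b) (at t)"
    "((\<lambda>s. fst (snd (snd (x s)))) has_real_derivative c) (at t)"
    "((\<lambda>s. snd (snd (snd (x s)))) has_real_derivative d) (at t)"
proof -
  note D = assms[unfolded has_vector_derivative_def]
  show "((\<lambda>s. fst (x s)) has_real_derivative a) (at t)"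
    using has_derivative_fst[OF D] by (simp add: has_field_derivative_def mult_commute_abs)
  show "((\<lambda>s. fst (snd (x s))) has_real_derivative b) (at t)"
    using has_derivative_fst[OF has_derivative_snd[OF D]]
    by (simp add: has_field_derivative_def mult_commute_abs)
  show "((\<lambda>s. fst (snd (snd (x s)))) has_real_derivative c) (at t)"
    using has_derivative_fst[OF has_derivative_snd[OF has_derivative_snd[OF D]]]
    by (simp add: has_field_derivative_def mult_commute_abs)
  show "((\<lambda>s. snd (snd (snd (x s)))) has_real_derivative d) (at t)"
    using has_derivative_snd[OF has_derivative_snd[OF has_derivative_snd[OF D]]]
    by (simp add: has_field_derivative_def mult_commute_abs)
qed

text \<open>\<open>g\<close> is the Lie derivative of \<open>f\<close> along the field. It is chosen
  before the curve \<open>x\<close> and is again regular, so differentiation can be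
  iterated.\<close>

lemma regular_deriv_along_flow:
  assumes F: "regular F1" "regular F2" "regular F3" "regular F4"
    and "regular f"
  obtains g where "regular g" "\<And>(x::real \<Rightarrow> state) t.
    (x has_vector_derivative (F1 (x t), F2 (x t), F3 (x t), F4 (x t))) (at t) \<Longrightarrow>
    ((\<lambda>s. f (x s)) has_real_derivative g (x t)) (at t)"
proof -
  define flow where "flow x t \<longleftrightarrow>
    (x has_vector_derivative (F1 (x t), F2 (x t), F3 (x t), F4 (x t))) (at t)" for x t
  note proj = has_vector_derivative_components[OF iffD1[OF flow_def]]
  have "\<exists>g. regular g \<and> (\<forall>x t. flow x t \<longrightarrow> ((\<lambda>s. f (x s)) has_real_derivative g (x t)) (at t))"
    using assms(5)
  proof induction
    case (const c)
    show ?case by (rule exI[of _ "\<lambda>p. 0"]) (auto intro: regular.intros)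
  next
    case sin
    show ?case by (rule exI[of _ "\<lambda>p. F1 p * cos (fst p)"])
        (auto intro!: regular.intros F derivative_eq_intros proj)
  next
    case cos
    show ?case by (rule exI[of _ "\<lambda>p. F1 p * (- sin (fst p))"])
        (auto intro!: regular_intros F derivative_eq_intros proj)
  next
    case (add f g)
    then obtain f' g' where "regular f'" "regular g'"
      "\<And>x t. flow x t \<Longrightarrow> ((\<lambda>s. f (x s)) has_real_derivative f' (x t)) (at t)"
      "\<And>x t. flow x t \<Longrightarrow> ((\<lambda>s. g (x s)) has_real_derivative g' (x t)) (at t)"
      by metis
    then show ?case by (intro exI[of _ "\<lambda>p. f' p + g' p"])
        (auto intro!: regular.intros derivative_eq_intros)
  next
    case (mult f g)
    then obtain f' g' where *: "regular f'" "regular g'"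
      "\<And>x t. flow x t \<Longrightarrow> ((\<lambda>s. f (x s)) has_real_derivative f' (x t)) (at t)"
      "\<And>x t. flow x t \<Longrightarrow> ((\<lambda>s. g (x s)) has_real_derivative g' (x t)) (at t)"
      by metis
    show ?case
    proof (intro exI[of _ "\<lambda>p. f' p * g p + g' p * f p"] conjI allI impI)
      show "((\<lambda>s. f (x s) * g (x s)) has_real_derivative f' (x t) * g (x t) + g' (x t) * f (x t)) (at t)"
        if "flow x t" for x t
        using *(3,4) that by (auto intro!: derivative_eq_intros)
    qed (use * mult in \<open>auto intro!: regular.intros\<close>)
  next
    case (inverse f)
    then obtain f' where *: "regular f'"
      "\<And>x t. flow x t \<Longrightarrow> ((\<lambda>s. f (x s)) has_real_derivative f' (x t)) (at t)"
      by metis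
    show ?case
    proof (intro exI[of _ "\<lambda>p. - (inverse (f p) * f' p * inverse (f p))"] conjI allI impI)
      show "((\<lambda>s. inverse (f (x s))) has_real_derivative - (inverse (f (x t)) * f' (x t) * inverse (f (x t)))) (at t)"
        if "flow x t" for x t
        using DERIV_inverse'[OF *(2)[OF that] inverse.hyps(2)] .
    qed (use * inverse in \<open>auto intro!: regular_intros\<close>)
  qed (use proj F in blast)+
  then show thesis
    using that unfolding flow_def by blast
qed

text \<open>Every iterated derivative coincides on \<open>T\<close> with a regular function of the
  state, hence is differentiable in turn. As \<open>T\<close> is open, agreement on \<open>T\<close>
  is enough to transfer derivatives.\<close>

lemma smooth_on_flow:
  assumes F: "regular F1" "regular F2" "regular F3" "regular F4" and "open T"
    and flow: "\<And>t. t \<in> T \<Longrightarrow> (x has_vector_derivative (F1 (x t), F2 (x t), F3 (x t), F4 (x t))) (at t)"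
    and "regular f"
  shows "smooth_on T (\<lambda>t. f (x t))"
proof -
  have "\<exists>g. regular g \<and> (\<forall>t\<in>T. (deriv ^^ n) (\<lambda>t. f (x t)) t = g (x t))" for n
  proof (induction n)
    case 0
    show ?case using assms(7) by auto
  next
    case (Suc n)
    then obtain g where g: "regular g" "\<And>t. t \<in> T \<Longrightarrow> (deriv ^^ n) (\<lambda>t. f (x t)) t = g (x t)" by blast
    from regular_deriv_along_flow[OF F g(1)] flow obtain g' where g': "regular g'"
      "\<And>t. t \<in> T \<Longrightarrow> ((\<lambda>s. g (x s)) has_real_derivative g' (x t)) (at t)" by metis
    have "((deriv ^^ n) (\<lambda>t. f (x t)) has_real_derivative g' (x t)) (at t)" if "t \<in> T" for t
      using has_field_derivative_transform_within_open[OF g'(2)[OF that] \<open>open T\<close> that] g(2) by metis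
    then show ?case
      using g'(1) DERIV_imp_deriv by fastforce
  qed
  moreover have "h differentiable_on T" if "regular g" "\<forall>t\<in>T. h t = g (x t)" for h g
  proof -
    from regular_deriv_along_flow[OF F that(1)] flow obtain g' where g':
      "\<And>t. t \<in> T \<Longrightarrow> ((\<lambda>s. g (x s)) has_real_derivative g' (x t)) (at t)" by metis
    have "(h has_real_derivative g' (x t)) (at t)" if "t \<in> T" for t
      using has_field_derivative_transform_within_open[OF g'[OF that] \<open>open T\<close> that]
        \<open>\<forall>t\<in>T. h t = g (x t)\<close> by metis
    then show ?thesis
      by (meson differentiable_at_imp_differentiable_on real_differentiable_def)
  qed
  ultimately show ?thesis
    unfolding smooth_on_def by meson
qed

text \<open>The closed ball is taken inside \<open>U\<close>, so the curve stays in
  \<open>U\<close>; this later confines the lean angle to \<open>lean_range\<close>.\<close>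

lemma regular_flow_exists:
  assumes F: "regular F1" "regular F2" "regular F3" "regular F4" and "open U" "x0 \<in> U"
  obtains h x where "h > 0" "x 0 = x0" "continuous_on {0..h} x" "x ` {0..h} \<subseteq> U"
    "\<And>t. t \<in> {0<..<h} \<Longrightarrow> (x has_vector_derivative (F1 (x t), F2 (x t), F3 (x t), F4 (x t))) (at t)"
    "\<And>f. regular f \<Longrightarrow> smooth_on {0<..<h} (\<lambda>t. f (x t))"
proof -
  obtain r where r: "r > 0" "cball x0 r \<subseteq> U"
    using assms(5,6) open_contains_cball by blast
  have lip: "\<exists>L. L-lipschitz_on (cball x0 r) f" if "regular f" for f
    using regular_lipschitz[OF that compact_cball] .
  obtain L1 where L1: "L1-lipschitz_on (cball x0 r) F1" using lip[OF F(1)] by blast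
  obtain L2 where L2: "L2-lipschitz_on (cball x0 r) F2" using lip[OF F(2)] by blast
  obtain L3 where L3: "L3-lipschitz_on (cball x0 r) F3" using lip[OF F(3)] by blast
  obtain L4 where L4: "L4-lipschitz_on (cball x0 r) F4" using lip[OF F(4)] by blast
  obtain h x where x: "h > 0" "x 0 = x0"
    "continuous_on {0..h} x" "x ` {0..h} \<subseteq> cball x0 r"
    "\<And>t. t \<in> {0..h} \<Longrightarrow>
      (x has_vector_derivative (F1 (x t), F2 (x t), F3 (x t), F4 (x t))) (at t within {0..h})"
    using picard_lindeloef_forward[OF lipschitz_on_Pair[OF L1
      lipschitz_on_Pair[OF L2 lipschitz_on_Pair[OF L3 L4]]] r(1)] by blast
  have flow: "(x has_vector_derivative (F1 (x t), F2 (x t), F3 (x t), F4 (x t))) (at t)"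
    if "t \<in> {0<..<h}" for t
    using x(5)[of t] that by (simp add: at_within_Icc_at)
  show thesis
  proof (rule that[OF x(1-3)])
    show "smooth_on {0<..<h} (\<lambda>t. f (x t))" if "regular f" for f
      by (rule smooth_on_flow[OF F _ flow that]) auto
  qed (use x(4) r flow in auto)
qed

section \<open>The equations of motion in components\<close>

lemma has_vector_derivative_vector_3:
  assumes "(f has_real_derivative f') (at t)" "(g has_real_derivative g') (at t)"
    "(h has_real_derivative h') (at t)"
  shows "((\<lambda>t. vector [f t, g t, h t] :: real^3) has_vector_derivative vector [f', g', h']) (at t)"
proof -
  have v: "(vector [a, b, c] :: real^3) = a *\<^sub>R axis 1 1 + b *\<^sub>R axis 2 1 + c *\<^sub>R axis 3 1"
    for a b c :: real
    by (simp add: vec_eq_iff forall_3 axis_def)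
  show ?thesis
    unfolding v using assms
    by (auto intro!: derivative_eq_intros simp: has_real_derivative_iff_has_vector_derivative)
qed

context includes cross3_syntax begin

text \<open>\<open>E1\<close>, \<open>Gam \<theta>\<close> and their cross product form an
  orthonormal basis, so a vector is a multiple of the third iff it is orthogonal to the first two.
  This eliminates the multiplier \<kappa>; the witness is the component along the cross
  product.\<close>

lemma ex_multiple_cross_iff:
  "(\<exists>k. X = k *\<^sub>R (E1 \<times> Gam \<theta>)) \<longleftrightarrow> X $ 1 = 0 \<and> sin \<theta> * X $ 2 + cos \<theta> * X $ 3 = 0"
proof
  assume *: "X $ 1 = 0 \<and> sin \<theta> * X $ 2 + cos \<theta> * X $ 3 = 0"
  have "X $ 2 = (cos \<theta> * X $ 2 - sin \<theta> * X $ 3) * cos \<theta> + sin \<theta> * (sin \<theta> * X $ 2 + cos \<theta> * X $ 3)"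
    "X $ 3 = (sin \<theta> * X $ 3 - cos \<theta> * X $ 2) * sin \<theta> + cos \<theta> * (sin \<theta> * X $ 2 + cos \<theta> * X $ 3)"
    using sin_cos_squared_add[of \<theta>] by algebra+
  with * show "\<exists>k. X = k *\<^sub>R (E1 \<times> Gam \<theta>)"
    by (intro exI[of _ "sin \<theta> * X $ 3 - cos \<theta> * X $ 2"])
      (simp add: vec_eq_iff forall_3 cross3_def E1_def Gam_def algebra_simps)
qed (auto simp: cross3_def E1_def Gam_def)

text \<open>The same basis eliminates \<nu> and \<mu>: the last two basis vectors span the
  complement of \<open>E1\<close>.\<close>

lemma ex_multiple_Gam_cross_iff:
  "(\<exists>n u. X = n *\<^sub>R Gam \<theta> + u *\<^sub>R (E1 \<times> Gam \<theta>)) \<longleftrightarrow> X $ 1 = 0"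
proof
  assume *: "X $ 1 = 0"
  have "X $ 2 = (sin \<theta> * X $ 2 + cos \<theta> * X $ 3) * sin \<theta> - (sin \<theta> * X $ 3 - cos \<theta> * X $ 2) * cos \<theta>"
    "X $ 3 = (sin \<theta> * X $ 2 + cos \<theta> * X $ 3) * cos \<theta> + (sin \<theta> * X $ 3 - cos \<theta> * X $ 2) * sin \<theta>"
    using sin_cos_squared_add[of \<theta>] by algebra+
  with * show "\<exists>n u. X = n *\<^sub>R Gam \<theta> + u *\<^sub>R (E1 \<times> Gam \<theta>)"
    by (intro exI[of _ "sin \<theta> * X $ 2 + cos \<theta> * X $ 3"] exI[of _ "sin \<theta> * X $ 3 - cos \<theta> * X $ 2"])
      (simp add: vec_eq_iff forall_3 cross3_def E1_def Gam_def algebra_simps)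
qed (auto simp: cross3_def E1_def Gam_def)

end

text \<open>\<open>a\<close>, \<open>b\<close>, \<open>d\<close> are the coordinates of the center
  of mass, \<open>a\<close> being the one along the blade, so the criterion for integrability reads
  \<open>a = 0\<close>.\<close>

locale skater =
  fixes m g I\<^sub>1 I\<^sub>2 I\<^sub>3 a b d :: real
  assumes m: "m > 0" and inertia: "I\<^sub>1 > 0" "I\<^sub>2 > 0" "I\<^sub>3 > 0"
begin

definition inert :: "real^3^3" where
  "inert = vector [vector [I\<^sub>1, 0, 0], vector [0, I\<^sub>2, 0], vector [0, 0, I\<^sub>3]]"

definition com :: "real^3" where
  "com = vector [a, b, d]"

text \<open>\<open>offset\<close> and \<open>height\<close> are the components of \<open>com\<close>
  along \<open>E1 \<times> Gam \<theta>\<close> and along \<open>Gam \<theta>\<close>, the \<xi> and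
  \<eta> of the overview; each is, up to sign, the derivative of the other.\<close>

definition offset :: "real \<Rightarrow> real" where
  "offset \<theta> = d * sin \<theta> - b * cos \<theta>"

definition height :: "real \<Rightarrow> real" where
  "height \<theta> = b * sin \<theta> + d * cos \<theta>"

text \<open>Moment of inertia about the blade axis through the contact point, by the parallel axis
  theorem.\<close>

definition J :: real where
  "J = I\<^sub>1 + m * (b\<^sup>2 + d\<^sup>2)"

text \<open>The moment of inertia about the vertical through the contact point is
  \<open>R \<theta> + m * (offset \<theta>)\<^sup>2\<close>; \<open>R\<close> is the coefficient of
  \<open>w2\<close> left in \<open>p_\<Omega>\<^sub>2\<close> after subtracting
  \<open>offset \<theta>\<close> times \<open>p_v\<close>.\<close>

definition R :: "real \<Rightarrow> real" where
  "R \<theta> = I\<^sub>2 * (sin \<theta>)\<^sup>2 + I\<^sub>3 * (cos \<theta>)\<^sup>2 + m * a\<^sup>2"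

section \<open>Momenta and projected equations of motion\<close>

lemma p_v_eq: "p_v m com \<theta> w1 w2 v = m * (v + w2 * offset \<theta>)"
  by (simp add: p_v_def lin_mom_def ang_vel_def lin_vel_def E1_def Gam_def com_def cross3_def
      inner_vec_def sum_3 offset_def algebra_simps)

lemma p_\<Omega>\<^sub>1_eq: "p_\<Omega>\<^sub>1 m inert com \<theta> w1 w2 v = J * w1 - m * a * height \<theta> * w2"
  by (simp add: p_\<Omega>\<^sub>1_def ang_mom_def lin_mom_def ang_vel_def lin_vel_def E1_def Gam_def com_def
      inert_def cross3_def inner_vec_def sum_3 matrix_vector_mult_def height_def J_def power2_eq_square
      algebra_simps)

lemma p_\<Omega>\<^sub>2_eq: "p_\<Omega>\<^sub>2 m inert com \<theta> w1 w2 v =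
    m * v * offset \<theta> + (R \<theta> + m * (offset \<theta>)\<^sup>2) * w2 - m * a * height \<theta> * w1"
proof -
  have "p_\<Omega>\<^sub>2 m inert com \<theta> w1 w2 v = m * v * offset \<theta> +
      (I\<^sub>2 * (sin \<theta>)\<^sup>2 + I\<^sub>3 * (cos \<theta>)\<^sup>2 + m * a\<^sup>2 * ((sin \<theta>)\<^sup>2 + (cos \<theta>)\<^sup>2) + m * (offset \<theta>)\<^sup>2) * w2
      - m * a * height \<theta> * w1"
    by (simp add: p_\<Omega>\<^sub>2_def ang_mom_def lin_mom_def ang_vel_def lin_vel_def E1_def Gam_def com_def
      inert_def cross3_def inner_vec_def sum_3 matrix_vector_mult_def height_def offset_def
      power2_eq_square algebra_simps del: sin_cos_squared_add3)
  then show ?thesis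
    by (simp add: R_def)
qed

lemma has_derivative_offset [derivative_intros]:
  "(f has_real_derivative f') (at x) \<Longrightarrow>
    ((\<lambda>x. offset (f x)) has_real_derivative height (f x) * f') (at x)"
  unfolding offset_def height_def by (auto intro!: derivative_eq_intros simp: algebra_simps)

lemma has_derivative_height [derivative_intros]:
  "(f has_real_derivative f') (at x) \<Longrightarrow>
    ((\<lambda>x. height (f x)) has_real_derivative - offset (f x) * f') (at x)"
  unfolding offset_def height_def by (auto intro!: derivative_eq_intros simp: algebra_simps)

text \<open>
  The equations of motion projected onto \<^term>\<open>E1\<close> and onto the vertical, the directions that
  the constraint forces do not act in.
\<close>

definition pv_rate :: "real \<Rightarrow> real \<Rightarrow> real \<Rightarrow> real \<Rightarrow> real" where
  "pv_rate \<theta> w1 w2 v = m * a * w2\<^sup>2 - m * height \<theta> * w1 * w2"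

definition p2_rate :: "real \<Rightarrow> real \<Rightarrow> real \<Rightarrow> real \<Rightarrow> real" where
  "p2_rate \<theta> w1 w2 v = m * v * (height \<theta> * w1 - a * w2)"

definition p1_rate :: "real \<Rightarrow> real \<Rightarrow> real \<Rightarrow> real \<Rightarrow> real" where
  "p1_rate \<theta> w1 w2 v = m * g * offset \<theta> - w2 * ((I\<^sub>3 - I\<^sub>2) * sin \<theta> * cos \<theta> * w2
     - m * a * offset \<theta> * w1 - m * height \<theta> * (v + w2 * offset \<theta>))"

text \<open>The kinematic equation says that the derivative of \<theta> is \<open>w1\<close>. Given
  this, the term \<open>\<Omega> \<times> M\<close> projected onto the vertical is what the product
  rule contributes when \<open>Gam \<bullet> M\<close> is differentiated, so the projection becomes
  an equation for the derivative of \<open>p_\<Omega>\<^sub>2\<close>. Gravity drops out of it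
  because \<open>Gam \<times> com\<close> is horizontal.\<close>

lemma equations_of_motion_iff:
  includes cross3_syntax
  fixes \<theta> w1 w2 v :: "real \<Rightarrow> real"
  defines "P \<equiv> \<lambda>t. lin_mom m com (\<theta> t) (w1 t) (w2 t) (v t)"
    and "M \<equiv> \<lambda>t. ang_mom m inert com (\<theta> t) (w1 t) (w2 t) (v t)"
    and "\<Omega> \<equiv> \<lambda>t. ang_vel (\<theta> t) (w1 t) (w2 t)"
  assumes "\<exists>D. (\<theta> has_real_derivative D) (at t)" "\<exists>D. (w1 has_real_derivative D) (at t)"
    "\<exists>D. (w2 has_real_derivative D) (at t)" "\<exists>D. (v has_real_derivative D) (at t)"
  shows "((\<exists>k. vector_derivative M (at t) + \<Omega> t \<times> M t - (m * g) *\<^sub>R (Gam (\<theta> t) \<times> com) + lin_vel (v t) \<times> P t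
             = k *\<^sub>R (E1 \<times> Gam (\<theta> t))) \<and>
          (\<exists>n u. vector_derivative P (at t) + \<Omega> t \<times> P t = n *\<^sub>R Gam (\<theta> t) + u *\<^sub>R (E1 \<times> Gam (\<theta> t))) \<and>
          vector_derivative (\<lambda>t. Gam (\<theta> t)) (at t) = - (\<Omega> t \<times> Gam (\<theta> t))) \<longleftrightarrow>
    (\<theta> has_real_derivative w1 t) (at t) \<and>
    ((\<lambda>t. p_v m com (\<theta> t) (w1 t) (w2 t) (v t)) has_real_derivative
       pv_rate (\<theta> t) (w1 t) (w2 t) (v t)) (at t) \<and>
    ((\<lambda>t. p_\<Omega>\<^sub>2 m inert com (\<theta> t) (w1 t) (w2 t) (v t)) has_real_derivative
       p2_rate (\<theta> t) (w1 t) (w2 t) (v t)) (at t) \<and>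
    ((\<lambda>t. p_\<Omega>\<^sub>1 m inert com (\<theta> t) (w1 t) (w2 t) (v t)) has_real_derivative
       p1_rate (\<theta> t) (w1 t) (w2 t) (v t)) (at t)"
proof -
  obtain \<theta>' w1' w2' v' where der: "(\<theta> has_real_derivative \<theta>') (at t)"
    "(w1 has_real_derivative w1') (at t)" "(w2 has_real_derivative w2') (at t)"
    "(v has_real_derivative v') (at t)"
    using assms by blast
  define s c where "s t = sin (\<theta> t)" and "c t = cos (\<theta> t)" for t
  define P1 P2 P3 where
    "P1 = (\<lambda>t. m * (v t + w2 t * (s t * d - c t * b)))" and
    "P2 = (\<lambda>t. m * (w2 t * c t * a - w1 t * d))" and
    "P3 = (\<lambda>t. m * (w1 t * b - w2 t * s t * a))"
  define M1 M2 M3 where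
    "M1 = (\<lambda>t. I\<^sub>1 * w1 t + (b * P3 t - d * P2 t))" and
    "M2 = (\<lambda>t. I\<^sub>2 * w2 t * s t + (d * P1 t - a * P3 t))" and
    "M3 = (\<lambda>t. I\<^sub>3 * w2 t * c t + (a * P2 t - b * P1 t))"
  have sc: "(s has_real_derivative c t * \<theta>') (at t)" "(c has_real_derivative - (s t * \<theta>')) (at t)"
    unfolding s_def c_def using der by (auto intro!: derivative_eq_intros)
  have P: "P = (\<lambda>t. vector [P1 t, P2 t, P3 t])"
    by (rule ext, simp add: P_def lin_mom_def ang_vel_def lin_vel_def E1_def Gam_def com_def cross3_def
        vec_eq_iff forall_3 P1_def P2_def P3_def s_def c_def algebra_simps)
  have "M t = vector [M1 t, M2 t, M3 t]" for t
    using fun_cong[OF P, of t] unfolding M_def ang_mom_def P_def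
    by (simp add: ang_vel_def E1_def Gam_def com_def cross3_def inert_def matrix_vector_mult_def sum_3
        vec_eq_iff forall_3 M1_def M2_def M3_def s_def c_def algebra_simps)
  then have M: "M = (\<lambda>t. vector [M1 t, M2 t, M3 t])" ..
  have "\<exists>D. (P1 has_real_derivative D) (at t)" "\<exists>D. (P2 has_real_derivative D) (at t)"
    "\<exists>D. (P3 has_real_derivative D) (at t)"
    unfolding P1_def P2_def P3_def by (rule exI, use der sc in \<open>auto intro!: derivative_eq_intros\<close>)+
  then obtain P1' P2' P3' where P': "(P1 has_real_derivative P1') (at t)"
    "(P2 has_real_derivative P2') (at t)" "(P3 has_real_derivative P3') (at t)"
    by blast
  have "\<exists>D. (M1 has_real_derivative D) (at t)" "\<exists>D. (M2 has_real_derivative D) (at t)"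
    "\<exists>D. (M3 has_real_derivative D) (at t)"
    unfolding M1_def M2_def M3_def by (rule exI, use der sc P' in \<open>auto intro!: derivative_eq_intros\<close>)+
  then obtain M1' M2' M3' where M': "(M1 has_real_derivative M1') (at t)"
    "(M2 has_real_derivative M2') (at t)" "(M3 has_real_derivative M3') (at t)"
    by blast
  have vP: "vector_derivative P (at t) = vector [P1', P2', P3']"
    unfolding P by (intro vector_derivative_at has_vector_derivative_vector_3 P')
  have vM: "vector_derivative M (at t) = vector [M1', M2', M3']"
    unfolding M by (intro vector_derivative_at has_vector_derivative_vector_3 M')
  have "vector_derivative (\<lambda>t. Gam (\<theta> t)) (at t) = vector [0, c t * \<theta>', - (s t * \<theta>')]"
    unfolding Gam_def s_def c_def using der
    by (intro vector_derivative_at has_vector_derivative_vector_3) (auto intro!: derivative_eq_intros)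
  moreover have "- (\<Omega> t \<times> Gam (\<theta> t)) = vector [0, c t * w1 t, - (s t * w1 t)]"
    by (simp add: \<Omega>_def ang_vel_def E1_def Gam_def cross3_def vec_eq_iff forall_3 s_def c_def)
  \<comment> \<open>Sine and cosine never vanish together, so one of the two factors can be
    cancelled.\<close>
  moreover have "c t * \<theta>' = c t * w1 t \<and> s t * \<theta>' = s t * w1 t \<longleftrightarrow> \<theta>' = w1 t"
    using sin_zero_abs_cos_one[of "\<theta> t"] unfolding s_def c_def by auto
  ultimately have Gam': "vector_derivative (\<lambda>t. Gam (\<theta> t)) (at t) = - (\<Omega> t \<times> Gam (\<theta> t))
      \<longleftrightarrow> \<theta>' = w1 t"
    by (simp add: vec_eq_iff forall_3)
  have lin: "(\<exists>n u. vector_derivative P (at t) + \<Omega> t \<times> P t = n *\<^sub>R Gam (\<theta> t) + u *\<^sub>R (E1 \<times> Gam (\<theta> t)))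
      \<longleftrightarrow> P1' + w2 t * (s t * P3 t - c t * P2 t) = 0"
    unfolding ex_multiple_Gam_cross_iff vP
    by (simp add: P \<Omega>_def ang_vel_def E1_def Gam_def cross3_def s_def c_def algebra_simps)
  have ang: "(\<exists>k. vector_derivative M (at t) + \<Omega> t \<times> M t - (m * g) *\<^sub>R (Gam (\<theta> t) \<times> com) + lin_vel (v t) \<times> P t
             = k *\<^sub>R (E1 \<times> Gam (\<theta> t))) \<longleftrightarrow>
      M1' + w2 t * (s t * M3 t - c t * M2 t) - m * g * offset (\<theta> t) = 0 \<and>
      s t * M2' + c t * M3' + w1 t * (c t * M2 t - s t * M3 t) + v t * (c t * P2 t - s t * P3 t) = 0"
    unfolding ex_multiple_cross_iff vM
    by (intro arg_cong2[where f = "(\<and>)"]; simp add: M P \<Omega>_def ang_vel_def lin_vel_def E1_def Gam_def cross3_def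
        com_def s_def c_def offset_def; simp add: algebra_simps)
  have pv: "((\<lambda>t. p_v m com (\<theta> t) (w1 t) (w2 t) (v t)) has_real_derivative D) (at t) \<longleftrightarrow> D = P1'" for D
  proof -
    have "(\<lambda>t. p_v m com (\<theta> t) (w1 t) (w2 t) (v t)) = P1"
      using P by (auto simp: fun_eq_iff p_v_def P_def E1_def inner_vec_def sum_3)
    then show ?thesis using P'(1) DERIV_unique by auto
  qed
  have p1: "((\<lambda>t. p_\<Omega>\<^sub>1 m inert com (\<theta> t) (w1 t) (w2 t) (v t)) has_real_derivative D) (at t) \<longleftrightarrow> D = M1'" for D
  proof -
    have "(\<lambda>t. p_\<Omega>\<^sub>1 m inert com (\<theta> t) (w1 t) (w2 t) (v t)) = M1"
      using M by (auto simp: fun_eq_iff p_\<Omega>\<^sub>1_def M_def E1_def inner_vec_def sum_3)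
    then show ?thesis using M'(1) DERIV_unique by auto
  qed
  have p2: "((\<lambda>t. p_\<Omega>\<^sub>2 m inert com (\<theta> t) (w1 t) (w2 t) (v t)) has_real_derivative D) (at t) \<longleftrightarrow>
      D = s t * M2' + c t * M3' + \<theta>' * (c t * M2 t - s t * M3 t)" for D
  proof -
    have "(\<lambda>t. p_\<Omega>\<^sub>2 m inert com (\<theta> t) (w1 t) (w2 t) (v t)) = (\<lambda>t. s t * M2 t + c t * M3 t)"
      using M by (auto simp: fun_eq_iff p_\<Omega>\<^sub>2_def M_def Gam_def inner_vec_def sum_3 s_def c_def)
    moreover have "((\<lambda>t. s t * M2 t + c t * M3 t) has_real_derivative
        s t * M2' + c t * M3' + \<theta>' * (c t * M2 t - s t * M3 t)) (at t)"
      using sc M' by (auto intro!: derivative_eq_intros simp: algebra_simps)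
    ultimately show ?thesis using DERIV_unique by auto
  qed
  have th: "(\<theta> has_real_derivative w1 t) (at t) \<longleftrightarrow> \<theta>' = w1 t"
    using der(1) DERIV_unique by auto
  have sc1: "s t * s t + c t * c t = 1"
    using sin_cos_squared_add[of "\<theta> t"] by (simp add: s_def c_def power2_eq_square)
  \<comment> \<open>This is the transverse component of the linear momentum, along
    \<open>E1 \<times> Gam\<close>; the rates of \<open>p_v\<close> and
    \<open>p_\<Omega>\<^sub>2\<close> are multiples of it.\<close>
  have cross_P: "s t * P3 t - c t * P2 t = m * (height (\<theta> t) * w1 t - a * w2 t)"
    unfolding P2_def P3_def height_def s_def[symmetric] c_def[symmetric] using sc1 by algebra
  have cross_M: "s t * M3 t - c t * M2 t = (I\<^sub>3 - I\<^sub>2) * s t * c t * w2 t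
      - m * a * offset (\<theta> t) * w1 t - m * height (\<theta> t) * (v t + w2 t * offset (\<theta> t))"
    unfolding M2_def M3_def P1_def P2_def P3_def height_def offset_def s_def[symmetric] c_def[symmetric]
    by (simp add: algebra_simps)
  have rates: "pv_rate (\<theta> t) (w1 t) (w2 t) (v t) = - (w2 t * (s t * P3 t - c t * P2 t))"
    "p2_rate (\<theta> t) (w1 t) (w2 t) (v t) = v t * (s t * P3 t - c t * P2 t)"
    "p1_rate (\<theta> t) (w1 t) (w2 t) (v t) = m * g * offset (\<theta> t) - w2 t * (s t * M3 t - c t * M2 t)"
    unfolding cross_P cross_M pv_rate_def p2_rate_def p1_rate_def
    by (simp_all add: s_def c_def power2_eq_square algebra_simps)
  show ?thesis
    unfolding Gam' lin ang pv p1 p2 th rates by (auto simp: algebra_simps)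
qed

lemma skater_solution_iff:
  "skater_solution m g inert com T \<theta> w1 w2 v \<longleftrightarrow>
     open T \<and> is_interval T \<and> smooth_on T \<theta> \<and> smooth_on T w1 \<and> smooth_on T w2 \<and> smooth_on T v \<and>
     (\<forall>t\<in>T. \<theta> t \<in> lean_range) \<and>
     (\<forall>t\<in>T. (\<theta> has_real_derivative w1 t) (at t) \<and>
       ((\<lambda>t. p_v m com (\<theta> t) (w1 t) (w2 t) (v t)) has_real_derivative
          pv_rate (\<theta> t) (w1 t) (w2 t) (v t)) (at t) \<and>
       ((\<lambda>t. p_\<Omega>\<^sub>2 m inert com (\<theta> t) (w1 t) (w2 t) (v t)) has_real_derivative
          p2_rate (\<theta> t) (w1 t) (w2 t) (v t)) (at t) \<and>
       ((\<lambda>t. p_\<Omega>\<^sub>1 m inert com (\<theta> t) (w1 t) (w2 t) (v t)) has_real_derivative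
          p1_rate (\<theta> t) (w1 t) (w2 t) (v t)) (at t))"
proof (cases "open T \<and> smooth_on T \<theta> \<and> smooth_on T w1 \<and> smooth_on T w2 \<and> smooth_on T v")
  case True
  have diff: "\<exists>f'. (f has_real_derivative f') (at t)" if "smooth_on T f" "t \<in> T" for f t
  proof -
    have "f differentiable_on T"
      using that(1) unfolding smooth_on_def by (metis funpow_0)
    then show ?thesis
      using True that(2) by (metis differentiable_on_eq_differentiable_at real_differentiable_def)
  qed
  \<comment> \<open>The multipliers may be arbitrary functions of time, so they can be chosen
    separately at each instant.\<close>
  have multipliers: "(\<exists>\<kappa> \<nu> \<mu>. \<forall>t\<in>T. A t (\<kappa> t) \<and> B t (\<nu> t) (\<mu> t) \<and> C t) \<longleftrightarrow>
      (\<forall>t\<in>T. (\<exists>k. A t k) \<and> (\<exists>n u. B t n u) \<and> C t)"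
    for A :: "real \<Rightarrow> real \<Rightarrow> bool" and B :: "real \<Rightarrow> real \<Rightarrow> real \<Rightarrow> bool" and C :: "real \<Rightarrow> bool"
  proof
    assume r: "\<forall>t\<in>T. (\<exists>k. A t k) \<and> (\<exists>n u. B t n u) \<and> C t"
    then obtain \<kappa> where "\<forall>t\<in>T. A t (\<kappa> t)" by metis
    moreover from r obtain \<nu> \<mu> where "\<forall>t\<in>T. B t (\<nu> t) (\<mu> t)" by metis
    ultimately show "\<exists>\<kappa> \<nu> \<mu>. \<forall>t\<in>T. A t (\<kappa> t) \<and> B t (\<nu> t) (\<mu> t) \<and> C t"
      using r by blast
  qed blast
  show ?thesis
    unfolding skater_solution_def Let_def
    by ((rule conj_cong[OF refl])+, rule trans[OF multipliers], rule ball_cong[OF refl],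
        rule equations_of_motion_iff)
      (use True diff in auto)
next
  case False
  then show ?thesis unfolding skater_solution_def Let_def by blast
qed

end

section \<open>Constants of motion and the vanishing of a quadratic form\<close>

text \<open>With \<open>x\<close>, \<open>y\<close>, \<open>z\<close> standing for
  \<open>w1\<close>, \<open>w2\<close>, \<open>v\<close>, these are the monomials that occur in the
  derivative of a linear momentum function; \<open>z\<^sup>2\<close> does not occur there. Six
  evaluations separate the coefficients.\<close>

lemma quadratic_form_zero:
  fixes k0 k11 k22 k12 k1v k2v :: real
  assumes q: "\<And>x y z. k0 + k11 * x\<^sup>2 + k22 * y\<^sup>2 + k12 * (x * y) + k1v * (x * z) + k2v * (y * z) = 0"
  shows "k0 = 0" "k11 = 0" "k22 = 0" "k12 = 0" "k1v = 0" "k2v = 0"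
proof -
  show 0: "k0 = 0" using q[of 0 0 0] by simp
  show 1: "k11 = 0" using q[of 1 0 0] 0 by simp
  show 2: "k22 = 0" using q[of 0 1 0] 0 by simp
  show "k12 = 0" using q[of 1 1 0] 0 1 2 by simp
  show "k1v = 0" using q[of 1 0 1] 0 1 2 by simp
  show "k2v = 0" using q[of 0 1 1] 0 1 2 by simp
qed

section \<open>Recovering velocities from momenta, and existence of solutions\<close>

context skater
begin

text \<open>Since \<open>(offset \<theta>)\<^sup>2 + (height \<theta>)\<^sup>2 = b\<^sup>2 +
  d\<^sup>2\<close>, the difference is
  \<open>I\<^sub>1 + m * (offset \<theta>)\<^sup>2\<close>.\<close>

lemma J_gt_height: "J - m * (height \<theta>)\<^sup>2 > 0"
proof -
  have "J - m * (height \<theta>)\<^sup>2 = I\<^sub>1 + m * (offset \<theta>)\<^sup>2"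
    unfolding J_def height_def offset_def using sin_cos_squared_add[of \<theta>] by algebra
  then show ?thesis
    using m inertia by (simp add: add_pos_nonneg)
qed

lemma J_pos: "J > 0"
  using m inertia by (simp add: J_def add_pos_nonneg)

lemma planar_inertia_pos: "I\<^sub>2 * (sin \<theta>)\<^sup>2 + I\<^sub>3 * (cos \<theta>)\<^sup>2 > 0"
proof (cases "sin \<theta> = 0")
  case True
  then have "(cos \<theta>)\<^sup>2 = 1" using sin_cos_squared_add[of \<theta>] by simp
  then show ?thesis using True inertia by simp
qed (use inertia in \<open>simp add: add_pos_nonneg\<close>)

text \<open>Determinant of the linear map from \<open>(w1, w2)\<close> to the pair of
  \<open>p_\<Omega>\<^sub>1\<close> and \<open>p_\<Omega>\<^sub>2\<close> minus
  \<open>offset \<theta>\<close> times \<open>p_v\<close>.\<close>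

definition disc :: "real \<Rightarrow> real" where
  "disc \<theta> = R \<theta> * J - (m * a * height \<theta>)\<^sup>2"

text \<open>The summand \<open>m * a\<^sup>2\<close> of \<open>R\<close>, multiplied by
  \<open>J\<close>, outweighs \<open>(m * a * height \<theta>)\<^sup>2\<close> because
  \<open>J\<close> exceeds \<open>m * (height \<theta>)\<^sup>2\<close>; the rest of
  \<open>R\<close> contributes a positive amount.\<close>

lemma disc_pos: "disc \<theta> > 0"
proof -
  have "disc \<theta> = (I\<^sub>2 * (sin \<theta>)\<^sup>2 + I\<^sub>3 * (cos \<theta>)\<^sup>2) * J + m * a\<^sup>2 * (J - m * (height \<theta>)\<^sup>2)"
    by (simp add: disc_def R_def power2_eq_square algebra_simps)
  moreover have "(I\<^sub>2 * (sin \<theta>)\<^sup>2 + I\<^sub>3 * (cos \<theta>)\<^sup>2) * J > 0"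
    using planar_inertia_pos J_pos by simp
  moreover have "m * a\<^sup>2 * (J - m * (height \<theta>)\<^sup>2) \<ge> 0"
    using m J_gt_height[of \<theta>] by simp
  ultimately show ?thesis by linarith
qed

text \<open>In momentum coordinates a state is \<open>(\<theta>, p_v, p_\<Omega>\<^sub>2, p_\<Omega>\<^sub>1)\<close>.\<close>

definition w2_of :: "state \<Rightarrow> real" where
  "w2_of p = (J * (fst (snd (snd p)) - offset (fst p) * fst (snd p)) +
     m * a * height (fst p) * snd (snd (snd p))) / disc (fst p)"

definition w1_of :: "state \<Rightarrow> real" where
  "w1_of p = (R (fst p) * snd (snd (snd p)) +
     m * a * height (fst p) * (fst (snd (snd p)) - offset (fst p) * fst (snd p))) / disc (fst p)"

definition v_of :: "state \<Rightarrow> real" where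
  "v_of p = fst (snd p) / m - offset (fst p) * w2_of p"

lemma momenta_of_velocities:
  "p_v m com (fst p) (w1_of p) (w2_of p) (v_of p) = fst (snd p)"
  "p_\<Omega>\<^sub>2 m inert com (fst p) (w1_of p) (w2_of p) (v_of p) = fst (snd (snd p))"
  "p_\<Omega>\<^sub>1 m inert com (fst p) (w1_of p) (w2_of p) (v_of p) = snd (snd (snd p))"
proof -
  obtain \<theta> x y z where p: "p = (\<theta>, x, y, z)" by (cases p) auto
  define k where "k = m * a * height \<theta>"
  define q where "q = y - offset \<theta> * x"
  have D: "R \<theta> * J - k * k > 0"
    using disc_pos[of \<theta>] by (simp add: disc_def k_def power2_eq_square)
  have w: "w1_of p = (R \<theta> * z + k * q) / (R \<theta> * J - k * k)"
    "w2_of p = (J * q + k * z) / (R \<theta> * J - k * k)"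
    "v_of p = x / m - offset \<theta> * w2_of p"
    by (simp_all add: p w1_of_def w2_of_def v_of_def disc_def k_def q_def power2_eq_square)
  have "R \<theta> * w2_of p - k * w1_of p = (R \<theta> * (J * q + k * z) - k * (R \<theta> * z + k * q)) / (R \<theta> * J - k * k)"
    unfolding w by (simp add: diff_divide_distrib)
  also have "\<dots> = q"
    using D by (simp add: field_simps)
  finally have 2: "R \<theta> * w2_of p - k * w1_of p = q" .
  have "J * w1_of p - k * w2_of p = (J * (R \<theta> * z + k * q) - k * (J * q + k * z)) / (R \<theta> * J - k * k)"
    unfolding w by (simp add: diff_divide_distrib)
  also have "\<dots> = z"
    using D by (simp add: field_simps)
  finally show "p_\<Omega>\<^sub>1 m inert com (fst p) (w1_of p) (w2_of p) (v_of p) = snd (snd (snd p))"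
    by (simp add: p_\<Omega>\<^sub>1_eq p k_def)
  show "p_v m com (fst p) (w1_of p) (w2_of p) (v_of p) = fst (snd p)"
    using m by (simp add: p_v_eq v_of_def)
  have "x = m * v_of p + m * offset \<theta> * w2_of p"
    using m by (simp add: w(3) field_simps)
  then have "p_\<Omega>\<^sub>2 m inert com \<theta> (w1_of p) (w2_of p) (v_of p) = offset \<theta> * x + (R \<theta> * w2_of p - k * w1_of p)"
    by (simp add: p_\<Omega>\<^sub>2_eq k_def power2_eq_square distrib_left distrib_right)
  then show "p_\<Omega>\<^sub>2 m inert com (fst p) (w1_of p) (w2_of p) (v_of p) = fst (snd (snd p))"
    using 2 by (simp add: p q_def)
qed

lemma velocities_of_momenta:
  fixes \<theta> w1 w2 v :: real
  defines "p \<equiv> (\<theta>, p_v m com \<theta> w1 w2 v, p_\<Omega>\<^sub>2 m inert com \<theta> w1 w2 v, p_\<Omega>\<^sub>1 m inert com \<theta> w1 w2 v)"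
  shows "w1_of p = w1" "w2_of p = w2" "v_of p = v"
proof -
  show w2: "w2_of p = w2"
    using disc_pos[of \<theta>]
    by (simp add: w2_of_def p_def p_v_eq p_\<Omega>\<^sub>1_eq p_\<Omega>\<^sub>2_eq field_simps)
      (simp add: disc_def power2_eq_square algebra_simps)
  show "w1_of p = w1"
    using disc_pos[of \<theta>]
    by (simp add: w1_of_def p_def p_v_eq p_\<Omega>\<^sub>1_eq p_\<Omega>\<^sub>2_eq field_simps)
      (simp add: disc_def power2_eq_square algebra_simps)
  show "v_of p = v"
    unfolding v_of_def w2 using m by (simp add: p_def p_v_eq field_simps)
qed

lemma regular_offset: "regular (\<lambda>p. offset (fst p))"
  and regular_height: "regular (\<lambda>p. height (fst p))"
  and regular_R: "regular (\<lambda>p. R (fst p))"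
  unfolding offset_def height_def R_def by (intro regular_intros)+

lemma regular_disc: "regular (\<lambda>p. disc (fst p))"
  unfolding disc_def by (intro regular_intros regular_R regular_height)

text \<open>\<open>disc\<close> is positive at every real angle, even outside
  \<open>lean_range\<close>, and \<open>regular.inverse\<close> demands a denominator without zeros
  on the whole state space.\<close>

lemma regular_velocities: "regular w1_of" "regular w2_of" "regular v_of"
proof -
  have "disc \<theta> \<noteq> 0" for \<theta> using disc_pos[of \<theta>] by simp
  then show "regular w1_of" and w2: "regular w2_of"
    unfolding w1_of_def[abs_def] w2_of_def[abs_def]
    by (intro regular_intros regular_R regular_height regular_offset regular_disc; simp)+
  show "regular v_of"
    unfolding v_of_def[abs_def] using w2 m by (intro regular_intros regular_offset) auto
qed

text \<open>
  The prescribed state is attained at the endpoint \<open>0\<close>, outside the open time interval of the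
  solution: a one-sided Picard iteration suffices, and identities along the solution extend to
  \<open>0\<close> by continuity.
\<close>

lemma skater_solution_exists:
  assumes "\<theta>0 \<in> lean_range"
  obtains h \<theta> w1 w2 v where "h > 0" "skater_solution m g inert com {0<..<h} \<theta> w1 w2 v"
    "continuous_on {0..h} \<theta>" "continuous_on {0..h} w1" "continuous_on {0..h} w2" "continuous_on {0..h} v"
    "\<theta> ` {0..h} \<subseteq> lean_range" "\<theta> 0 = \<theta>0" "w1 0 = a1" "w2 0 = a2" "v 0 = a3"
proof -
  define p0 where "p0 = (\<theta>0, p_v m com \<theta>0 a1 a2 a3, p_\<Omega>\<^sub>2 m inert com \<theta>0 a1 a2 a3, p_\<Omega>\<^sub>1 m inert com \<theta>0 a1 a2 a3)"
  \<comment> \<open>In momentum coordinates the projected equations are already solved for the time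
    derivatives; the velocities enter only through \<open>w1_of\<close>, \<open>w2_of\<close> and
    \<open>v_of\<close>.\<close>
  let ?F = "\<lambda>f p. f (fst p) (w1_of p) (w2_of p) (v_of p)"
  note reg = regular_velocities regular_height regular_offset regular_intros
  have F: "regular (?F pv_rate)" "regular (?F p2_rate)" "regular (?F p1_rate)"
    unfolding pv_rate_def p2_rate_def p1_rate_def by (intro reg)+
  have "open (lean_range \<times> (UNIV :: (real \<times> real \<times> real) set))"
    unfolding lean_range_def by (intro open_Times) auto
  moreover have "p0 \<in> lean_range \<times> UNIV"
    using assms by (simp add: p0_def)
  ultimately obtain h x where x: "h > 0" "x 0 = p0" "continuous_on {0..h} x"
    "x ` {0..h} \<subseteq> lean_range \<times> UNIV"
    "\<And>t. t \<in> {0<..<h} \<Longrightarrow> (x has_vector_derivative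
        (w1_of (x t), ?F pv_rate (x t), ?F p2_rate (x t), ?F p1_rate (x t))) (at t)"
    "\<And>f. regular f \<Longrightarrow> smooth_on {0<..<h} (\<lambda>t. f (x t))"
    using regular_flow_exists[OF regular_velocities(1) F] by blast
  have cont: "continuous_on {0..h} (\<lambda>t. f (x t))" if "regular f" for f
    using continuous_on_compose2[OF regular_continuous_on[OF that, of UNIV] x(3)] by simp
  have proj: "((\<lambda>s. fst (x s)) has_real_derivative w1_of (x t)) (at t)"
    "((\<lambda>s. fst (snd (x s))) has_real_derivative ?F pv_rate (x t)) (at t)"
    "((\<lambda>s. fst (snd (snd (x s)))) has_real_derivative ?F p2_rate (x t)) (at t)"
    "((\<lambda>s. snd (snd (snd (x s)))) has_real_derivative ?F p1_rate (x t)) (at t)"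
    if "t \<in> {0<..<h}" for t
    using has_vector_derivative_components[OF x(5)[OF that]] by auto
  have "skater_solution m g inert com {0<..<h} (\<lambda>t. fst (x t)) (\<lambda>t. w1_of (x t)) (\<lambda>t. w2_of (x t)) (\<lambda>t. v_of (x t))"
    unfolding skater_solution_iff momenta_of_velocities
    using x(4) proj x(6) regular_velocities regular.proj1
    by (auto simp: is_interval_oo image_subset_iff mem_Times_iff)
  moreover have "(\<lambda>t. fst (x t)) ` {0..h} \<subseteq> lean_range"
    using x(4) by (auto simp: image_subset_iff mem_Times_iff)
  moreover have "fst (x 0) = \<theta>0" "w1_of (x 0) = a1" "w2_of (x 0) = a2" "v_of (x 0) = a3"
    unfolding x(2) p0_def by (simp_all add: velocities_of_momenta)
  ultimately show thesis
    using that x(1) cont regular_velocities regular.proj1 by metis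
qed

text \<open>
  The time derivative of \<open>\<alpha> p_v + \<beta> p_\<Omega>\<^sub>2 + \<gamma> p_\<Omega>\<^sub>1\<close>, where a primed argument is the value of
  the derivative of the coefficient with respect to the lean angle.
\<close>

definition drift :: "real \<Rightarrow> real \<Rightarrow> real \<Rightarrow> real \<Rightarrow> real \<Rightarrow> real \<Rightarrow> real \<Rightarrow> real \<Rightarrow> real \<Rightarrow> real \<Rightarrow> real" where
  "drift \<alpha> \<alpha>' \<beta> \<beta>' \<gamma> \<gamma>' \<theta> w1 w2 v =
     w1 * (\<alpha>' * p_v m com \<theta> w1 w2 v + \<beta>' * p_\<Omega>\<^sub>2 m inert com \<theta> w1 w2 v + \<gamma>' * p_\<Omega>\<^sub>1 m inert com \<theta> w1 w2 v)
     + \<alpha> * pv_rate \<theta> w1 w2 v + \<beta> * p2_rate \<theta> w1 w2 v + \<gamma> * p1_rate \<theta> w1 w2 v"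

text \<open>Sorting by monomials in the velocities prepares the comparison of coefficients; gravity
  is the only contribution free of velocities.\<close>

lemma drift_eq:
  "drift \<alpha> \<alpha>' \<beta> \<beta>' \<gamma> \<gamma>' \<theta> w1 w2 v =
     \<gamma> * m * g * offset \<theta>
     + (J * \<gamma>' - m * a * height \<theta> * \<beta>') * w1\<^sup>2
     + (m * a * \<alpha> + \<gamma> * (m * offset \<theta> * height \<theta> - (I\<^sub>3 - I\<^sub>2) * sin \<theta> * cos \<theta>)) * w2\<^sup>2
     + (m * offset \<theta> * \<alpha>' + (R \<theta> + m * (offset \<theta>)\<^sup>2) * \<beta>' - m * a * height \<theta> * \<gamma>'
          - m * height \<theta> * \<alpha> + m * a * offset \<theta> * \<gamma>) * (w1 * w2)
     + (m * \<alpha>' + m * offset \<theta> * \<beta>' + m * height \<theta> * \<beta>) * (w1 * v)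
     + (m * height \<theta> * \<gamma> - m * a * \<beta>) * (w2 * v)"
  unfolding drift_def p_v_eq p_\<Omega>\<^sub>1_eq p_\<Omega>\<^sub>2_eq pv_rate_def p2_rate_def p1_rate_def
  by (simp add: power2_eq_square algebra_simps)

text \<open>The conditions come from the coefficients of \<open>w1\<^sup>2\<close>,
  \<open>w2\<^sup>2\<close>, \<open>w1 * w2\<close>, \<open>w1 * v\<close>, \<open>w2 * v\<close> in
  this order, with \<open>m\<close> cancelled in the last two.\<close>

lemma drift_zero_coefficients:
  assumes "\<And>w1 w2 v. drift \<alpha> \<alpha>' \<beta> \<beta>' \<gamma> \<gamma>' \<theta> w1 w2 v = 0"
  shows "J * \<gamma>' = m * a * height \<theta> * \<beta>'"
    and "m * a * \<alpha> = \<gamma> * ((I\<^sub>3 - I\<^sub>2) * sin \<theta> * cos \<theta> - m * offset \<theta> * height \<theta>)"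
    and "m * offset \<theta> * \<alpha>' + (R \<theta> + m * (offset \<theta>)\<^sup>2) * \<beta>' - m * a * height \<theta> * \<gamma>'
          - m * height \<theta> * \<alpha> + m * a * offset \<theta> * \<gamma> = 0"
    and "\<alpha>' + offset \<theta> * \<beta>' + height \<theta> * \<beta> = 0"
    and "height \<theta> * \<gamma> = a * \<beta>"
proof -
  note q = quadratic_form_zero[OF assms[unfolded drift_eq]]
  show "J * \<gamma>' = m * a * height \<theta> * \<beta>'"
    using q(2) by simp
  show "m * a * \<alpha> = \<gamma> * ((I\<^sub>3 - I\<^sub>2) * sin \<theta> * cos \<theta> - m * offset \<theta> * height \<theta>)"
    using q(3) by (simp add: algebra_simps)
  show "m * offset \<theta> * \<alpha>' + (R \<theta> + m * (offset \<theta>)\<^sup>2) * \<beta>' - m * a * height \<theta> * \<gamma>'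
          - m * height \<theta> * \<alpha> + m * a * offset \<theta> * \<gamma> = 0"
    using q(4) .
  have "m * (\<alpha>' + offset \<theta> * \<beta>' + height \<theta> * \<beta>) = 0"
    using q(5) by (simp add: algebra_simps)
  then show "\<alpha>' + offset \<theta> * \<beta>' + height \<theta> * \<beta> = 0" using m by simp
  have "m * (height \<theta> * \<gamma> - a * \<beta>) = 0"
    using q(6) by (simp add: algebra_simps)
  then show "height \<theta> * \<gamma> = a * \<beta>" using m by simp
qed

lemma has_derivative_linear_momentum:
  assumes sol: "skater_solution m g inert com T \<theta> w1 w2 v" and t: "t \<in> T"
    and d: "(\<alpha> has_real_derivative \<alpha>') (at (\<theta> t))" "(\<beta> has_real_derivative \<beta>') (at (\<theta> t))"
      "(\<gamma> has_real_derivative \<gamma>') (at (\<theta> t))"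
  shows "((\<lambda>t. \<alpha> (\<theta> t) * p_v m com (\<theta> t) (w1 t) (w2 t) (v t)
          + \<beta> (\<theta> t) * p_\<Omega>\<^sub>2 m inert com (\<theta> t) (w1 t) (w2 t) (v t)
          + \<gamma> (\<theta> t) * p_\<Omega>\<^sub>1 m inert com (\<theta> t) (w1 t) (w2 t) (v t)) has_real_derivative
       drift (\<alpha> (\<theta> t)) \<alpha>' (\<beta> (\<theta> t)) \<beta>' (\<gamma> (\<theta> t)) \<gamma>' (\<theta> t) (w1 t) (w2 t) (v t)) (at t)"
proof -
  have s: "(\<theta> has_real_derivative w1 t) (at t)"
    "((\<lambda>t. p_v m com (\<theta> t) (w1 t) (w2 t) (v t)) has_real_derivative
          pv_rate (\<theta> t) (w1 t) (w2 t) (v t)) (at t)"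
    "((\<lambda>t. p_\<Omega>\<^sub>2 m inert com (\<theta> t) (w1 t) (w2 t) (v t)) has_real_derivative
          p2_rate (\<theta> t) (w1 t) (w2 t) (v t)) (at t)"
    "((\<lambda>t. p_\<Omega>\<^sub>1 m inert com (\<theta> t) (w1 t) (w2 t) (v t)) has_real_derivative
          p1_rate (\<theta> t) (w1 t) (w2 t) (v t)) (at t)"
    using sol t unfolding skater_solution_iff by auto
  note c = DERIV_chain2[OF d(1) s(1)] DERIV_chain2[OF d(2) s(1)] DERIV_chain2[OF d(3) s(1)]
  show ?thesis
    by (rule DERIV_cong[OF DERIV_add[OF DERIV_add[OF DERIV_mult[OF c(1) s(2)] DERIV_mult[OF c(2) s(3)]]
          DERIV_mult[OF c(3) s(4)]]])
      (simp add: drift_def algebra_simps)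
qed

lemma linear_constant_of_motionI:
  assumes d: "\<And>\<theta>. \<theta> \<in> lean_range \<Longrightarrow> (\<alpha> has_real_derivative \<alpha>' \<theta>) (at \<theta>)"
      "\<And>\<theta>. \<theta> \<in> lean_range \<Longrightarrow> (\<beta> has_real_derivative \<beta>' \<theta>) (at \<theta>)"
      "\<And>\<theta>. \<theta> \<in> lean_range \<Longrightarrow> (\<gamma> has_real_derivative \<gamma>' \<theta>) (at \<theta>)"
    and c: "continuous_on lean_range \<alpha>'" "continuous_on lean_range \<beta>'" "continuous_on lean_range \<gamma>'"
    and z: "\<And>\<theta> w1 w2 v. \<theta> \<in> lean_range \<Longrightarrow>
      drift (\<alpha> \<theta>) (\<alpha>' \<theta>) (\<beta> \<theta>) (\<beta>' \<theta>) (\<gamma> \<theta>) (\<gamma>' \<theta>) \<theta> w1 w2 v = 0"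
  shows "linear_constant_of_motion m g inert com \<alpha> \<beta> \<gamma>"
  unfolding linear_constant_of_motion_def
proof (intro conjI allI impI)
  show "\<alpha> C1_differentiable_on lean_range" "\<beta> C1_differentiable_on lean_range" "\<gamma> C1_differentiable_on lean_range"
    unfolding C1_differentiable_on_def has_real_derivative_iff_has_vector_derivative[symmetric]
    using d c by blast+
  fix T \<theta> w1 w2 v
  assume sol: "skater_solution m g inert com T \<theta> w1 w2 v"
  then have T: "convex T" "\<And>t. t \<in> T \<Longrightarrow> \<theta> t \<in> lean_range"
    unfolding skater_solution_iff by (auto simp: is_interval_convex)
  show "(\<lambda>t. \<alpha> (\<theta> t) * p_v m com (\<theta> t) (w1 t) (w2 t) (v t)
          + \<beta> (\<theta> t) * p_\<Omega>\<^sub>2 m inert com (\<theta> t) (w1 t) (w2 t) (v t)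
          + \<gamma> (\<theta> t) * p_\<Omega>\<^sub>1 m inert com (\<theta> t) (w1 t) (w2 t) (v t)) constant_on T"
    unfolding constant_on_def
  proof (rule has_field_derivative_zero_constant[OF T(1)])
    fix t assume t: "t \<in> T"
    show "((\<lambda>t. \<alpha> (\<theta> t) * p_v m com (\<theta> t) (w1 t) (w2 t) (v t)
          + \<beta> (\<theta> t) * p_\<Omega>\<^sub>2 m inert com (\<theta> t) (w1 t) (w2 t) (v t)
          + \<gamma> (\<theta> t) * p_\<Omega>\<^sub>1 m inert com (\<theta> t) (w1 t) (w2 t) (v t)) has_real_derivative 0) (at t within T)"
      using has_derivative_linear_momentum[OF sol t d[OF T(2)[OF t]]] z[OF T(2)[OF t]]
      by (simp add: has_field_derivative_at_within)
  qed
qed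

text \<open>Along each solution the constant of motion has derivative zero, and this derivative is
  the drift. Since a solution starts at every state, the drift vanishes for all velocities at each
  lean angle.\<close>

lemma linear_constant_of_motionE:
  assumes lin: "linear_constant_of_motion m g inert com \<alpha> \<beta> \<gamma>"
  obtains \<alpha>' \<beta>' \<gamma>' where
      "\<And>\<theta>. \<theta> \<in> lean_range \<Longrightarrow> (\<alpha> has_real_derivative \<alpha>' \<theta>) (at \<theta>)"
      "\<And>\<theta>. \<theta> \<in> lean_range \<Longrightarrow> (\<beta> has_real_derivative \<beta>' \<theta>) (at \<theta>)"
      "\<And>\<theta>. \<theta> \<in> lean_range \<Longrightarrow> (\<gamma> has_real_derivative \<gamma>' \<theta>) (at \<theta>)"
      "\<And>\<theta> w1 w2 v. \<theta> \<in> lean_range \<Longrightarrow>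
        drift (\<alpha> \<theta>) (\<alpha>' \<theta>) (\<beta> \<theta>) (\<beta>' \<theta>) (\<gamma> \<theta>) (\<gamma>' \<theta>) \<theta> w1 w2 v = 0"
proof -
  obtain \<alpha>' \<beta>' \<gamma>' where
    d: "\<And>\<theta>. \<theta> \<in> lean_range \<Longrightarrow> (\<alpha> has_real_derivative \<alpha>' \<theta>) (at \<theta>)"
      "\<And>\<theta>. \<theta> \<in> lean_range \<Longrightarrow> (\<beta> has_real_derivative \<beta>' \<theta>) (at \<theta>)"
      "\<And>\<theta>. \<theta> \<in> lean_range \<Longrightarrow> (\<gamma> has_real_derivative \<gamma>' \<theta>) (at \<theta>)"
    and c: "continuous_on lean_range \<alpha>'" "continuous_on lean_range \<beta>'" "continuous_on lean_range \<gamma>'"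
    using lin unfolding linear_constant_of_motion_def C1_differentiable_on_def
      has_real_derivative_iff_has_vector_derivative[symmetric] by blast
  have c0: "continuous_on lean_range \<alpha>" "continuous_on lean_range \<beta>" "continuous_on lean_range \<gamma>"
    using d by (meson DERIV_isCont continuous_at_imp_continuous_on)+
  have "drift (\<alpha> \<theta>0) (\<alpha>' \<theta>0) (\<beta> \<theta>0) (\<beta>' \<theta>0) (\<gamma> \<theta>0) (\<gamma>' \<theta>0) \<theta>0 a1 a2 a3 = 0"
    if \<theta>0: "\<theta>0 \<in> lean_range" for \<theta>0 a1 a2 a3
  proof -
    obtain h \<theta> w1 w2 v where h: "h > 0" and sol: "skater_solution m g inert com {0<..<h} \<theta> w1 w2 v"
      and cont: "continuous_on {0..h} \<theta>" "continuous_on {0..h} w1" "continuous_on {0..h} w2" "continuous_on {0..h} v"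
      and range: "\<theta> ` {0..h} \<subseteq> lean_range" and init: "\<theta> 0 = \<theta>0" "w1 0 = a1" "w2 0 = a2" "v 0 = a3"
      using skater_solution_exists[OF \<theta>0] by metis
    define q where "q t = drift (\<alpha> (\<theta> t)) (\<alpha>' (\<theta> t)) (\<beta> (\<theta> t)) (\<beta>' (\<theta> t)) (\<gamma> (\<theta> t)) (\<gamma>' (\<theta> t))
      (\<theta> t) (w1 t) (w2 t) (v t)" for t
    have zero: "q t = 0" if t: "t \<in> {0<..<h}" for t
    proof -
      let ?C = "\<lambda>t. \<alpha> (\<theta> t) * p_v m com (\<theta> t) (w1 t) (w2 t) (v t)
          + \<beta> (\<theta> t) * p_\<Omega>\<^sub>2 m inert com (\<theta> t) (w1 t) (w2 t) (v t)
          + \<gamma> (\<theta> t) * p_\<Omega>\<^sub>1 m inert com (\<theta> t) (w1 t) (w2 t) (v t)"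
      have "\<theta> t \<in> lean_range"
        using range t by auto
      then have C: "(?C has_real_derivative q t) (at t)"
        unfolding q_def by (intro has_derivative_linear_momentum[OF sol t] d)
      have "?C constant_on {0<..<h}"
        using lin sol unfolding linear_constant_of_motion_def by blast
      then obtain k where k: "\<And>s. s \<in> {0<..<h} \<Longrightarrow> ?C s = k"
        unfolding constant_on_def by blast
      have "(?C has_real_derivative 0) (at t)"
        by (rule has_field_derivative_transform_within_open[OF DERIV_const[of k] _ t]) (use k in auto)
      then show ?thesis
        using C DERIV_unique by blast
    qed
    \<comment> \<open>Continuity of the derivatives of the coefficients enters here: it carries the
      zero from the open time interval to the initial state at time 0.\<close>
    have "continuous_on {0..h} q"
      unfolding q_def drift_eq offset_def height_def R_def
      by (intro continuous_intros cont continuous_on_compose2[OF c(1) cont(1) range]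
          continuous_on_compose2[OF c(2) cont(1) range] continuous_on_compose2[OF c(3) cont(1) range]
          continuous_on_compose2[OF c0(1) cont(1) range] continuous_on_compose2[OF c0(2) cont(1) range]
          continuous_on_compose2[OF c0(3) cont(1) range])
    then have "q 0 = 0"
      using continuous_constant_on_closure[of "{0<..<h}" q 0] zero h by simp
    then show ?thesis
      by (simp add: q_def init)
  qed
  then show thesis
    using that d by blast
qed

end

section \<open>Elementary coefficients\<close>

lemma has_real_derivative_zero_lean_range:
  assumes "\<And>\<theta>. \<theta> \<in> lean_range \<Longrightarrow> (f has_real_derivative 0) (at \<theta>)"
  obtains c :: real where "\<And>\<theta>. \<theta> \<in> lean_range \<Longrightarrow> f \<theta> = c"
proof -
  have "\<exists>c. \<forall>\<theta>\<in>lean_range. f \<theta> = c"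
    by (rule has_field_derivative_zero_constant)
      (use assms in \<open>auto simp: lean_range_def has_field_derivative_at_within\<close>)
  then show thesis using that by blast
qed

section \<open>Elementary functions and antiderivatives\<close>

lemma elementary_on_uminus: "elementary_on X f \<Longrightarrow> elementary_on X (\<lambda>x. - f x)"
  using elementary_on.diff[OF elementary_on.const[of X 0]] by simp

lemma elementary_on_power: "elementary_on X f \<Longrightarrow> elementary_on X (\<lambda>x. f x ^ n)"
  by (induction n) (auto intro: elementary_on.const elementary_on.mult)

lemma elementary_on_sqrt:
  assumes "elementary_on X f" "\<And>x. x \<in> X \<Longrightarrow> f x > 0"
  shows "elementary_on X (\<lambda>x. sqrt (f x))"
proof (rule elementary_on.cong)
  show "elementary_on X (\<lambda>x. exp (ln (f x) / 2))"
    using assms by (intro elementary_on.exp elementary_on.divide elementary_on.ln elementary_on.const) auto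
  show "sqrt (f x) = exp (ln (f x) / 2)" if "x \<in> X" for x
  proof -
    have "ln (sqrt (f x)) = ln (f x) / 2"
      using assms(2)[OF that] by (intro ln_sqrt) simp
    then have "exp (ln (f x) / 2) = exp (ln (sqrt (f x)))" by (rule arg_cong[OF sym])
    then show ?thesis using assms(2)[OF that] by simp
  qed
qed

lemmas elementary_intros = elementary_on.const elementary_on.ident elementary_on.add
  elementary_on.diff elementary_on.mult elementary_on.divide elementary_on.sin elementary_on.cos
  elementary_on_uminus elementary_on_power elementary_on_sqrt

text \<open>Depending on the sign of \<open>e\<close> the antiderivative is linear, an arctangent,
  or a difference of logarithms from partial fractions. The two assumptions make the denominator
  positive for \<open>\<bar>u\<bar> \<le> 1\<close>, the range of the sine and cosine that are later
  substituted for \<open>u\<close>.\<close>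

lemma inverse_quadratic_elementary_antiderivative:
  fixes q e :: real
  assumes "q > 0" "q + e > 0"
  obtains S where "\<And>u. \<bar>u\<bar> \<le> 1 \<Longrightarrow> (S has_real_derivative 1 / (q + e * u\<^sup>2)) (at u)"
    "\<And>X f. elementary_on X f \<Longrightarrow> (\<And>x. x \<in> X \<Longrightarrow> \<bar>f x\<bar> \<le> 1) \<Longrightarrow> elementary_on X (\<lambda>x. S (f x))"
proof -
  consider "e = 0" | "e > 0" | "e < 0" by linarith
  then show thesis
  proof cases
    case 1
    show thesis
    proof (rule that[of "\<lambda>u. u / q"])
      show "((\<lambda>u. u / q) has_real_derivative 1 / (q + e * u\<^sup>2)) (at u)" for u
        using 1 assms by (auto intro!: derivative_eq_intros)
    qed (use assms in \<open>auto intro!: elementary_intros\<close>)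
  next
    case 2
    define r where "r = sqrt (e / q)"
    have r: "r > 0" "e = q * r\<^sup>2"
      using 2 assms by (auto simp: r_def)
    show thesis
    proof (rule that[of "\<lambda>u. arctan (r * u) / (q * r)"])
      fix u
      have "1 + (r * u)\<^sup>2 > 0" by (simp add: add_pos_nonneg)
      moreover have "q + e * u\<^sup>2 = q * (1 + (r * u)\<^sup>2)"
        by (simp add: r power_mult_distrib algebra_simps)
      moreover have "((\<lambda>u. arctan (r * u) / (q * r)) has_real_derivative
          (r / (1 + (r * u)\<^sup>2)) / (q * r)) (at u)"
        by (auto intro!: derivative_eq_intros simp: divide_inverse mult.commute)
      moreover have "(r / (1 + (r * u)\<^sup>2)) / (q * r) = 1 / (q * (1 + (r * u)\<^sup>2))"
        using r(1) by simp
      ultimately show "((\<lambda>u. arctan (r * u) / (q * r)) has_real_derivative 1 / (q + e * u\<^sup>2)) (at u)"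
        by simp
    qed (use r assms in \<open>auto intro!: elementary_intros elementary_on.arctan\<close>)
  next
    case 3
    \<comment> \<open>The scaling gives \<open>e = - q * r\<^sup>2\<close>, so the denominator
      factors; \<open>q + e > 0\<close> becomes \<open>r < 1\<close>, which keeps both logarithms
      defined.\<close>
    define r where "r = sqrt (- e / q)"
    have r: "r > 0" "e = - q * r\<^sup>2" "r < 1"
      using 3 assms by (auto simp: r_def field_simps)
    have pos: "1 + r * u > 0" "1 - r * u > 0" if "\<bar>u\<bar> \<le> 1" for u
    proof -
      have "\<bar>r * u\<bar> = r * \<bar>u\<bar>"
        using r(1) by (simp add: abs_mult)
      also have "\<dots> \<le> r"
        using r(1) that by (intro mult_left_le) auto
      finally have "\<bar>r * u\<bar> < 1"
        using r(3) by linarith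
      then show "1 + r * u > 0" "1 - r * u > 0" by (simp_all add: abs_less_iff)
    qed
    show thesis
    proof (rule that[of "\<lambda>u. (ln (1 + r * u) - ln (1 - r * u)) / (2 * q * r)"])
      fix u :: real assume u: "\<bar>u\<bar> \<le> 1"
      have "q + e * u\<^sup>2 = q * ((1 + r * u) * (1 - r * u))"
        by (simp add: r(2) power2_eq_square algebra_simps)
      moreover have "(r / (1 + r * u) - (- r) / (1 - r * u)) / (2 * q * r)
          = 1 / (q * ((1 + r * u) * (1 - r * u)))"
        using pos[OF u] r(1) assms(1) by (simp add: divide_simps) (simp add: algebra_simps)
      moreover have "((\<lambda>u. (ln (1 + r * u) - ln (1 - r * u)) / (2 * q * r)) has_real_derivative
          (r / (1 + r * u) - (- r) / (1 - r * u)) / (2 * q * r)) (at u)"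
        using pos[OF u] by (intro DERIV_cdivide DERIV_diff) (auto intro!: derivative_eq_intros)
      ultimately show "((\<lambda>u. (ln (1 + r * u) - ln (1 - r * u)) / (2 * q * r)) has_real_derivative
          1 / (q + e * u\<^sup>2)) (at u)" by simp
    qed (use pos r assms in \<open>auto intro!: elementary_intros elementary_on.ln\<close>)
  qed
qed

section \<open>Solving for the coefficients when \<open>a = 0\<close> and when
  \<open>a \<noteq> 0\<close>\<close>

context skater
begin

lemma elementary_offset: "elementary_on X offset"
  and elementary_height: "elementary_on X height"
  unfolding offset_def height_def by (intro elementary_intros)+

lemma continuous_on_offset: "continuous_on X offset"
  and continuous_on_height: "continuous_on X height"
  unfolding offset_def height_def by (intro continuous_intros)+

text \<open>Split \<open>height\<close> into its cosine and sine parts. As \<open>R\<close> is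
  affine in the square of the sine and also in that of the cosine, substituting
  \<open>u = sin \<theta>\<close> and \<open>u = cos \<theta>\<close> leaves inverse quadratics in
  \<open>u\<close>.\<close>

lemma height_antiderivative:
  assumes "a = 0"
  obtains B where "\<And>\<theta>. (B has_real_derivative m * height \<theta> / R \<theta>) (at \<theta>)" "\<And>X. elementary_on X B"
proof -
  obtain S where S: "\<And>u. \<bar>u\<bar> \<le> 1 \<Longrightarrow> (S has_real_derivative 1 / (I\<^sub>3 + (I\<^sub>2 - I\<^sub>3) * u\<^sup>2)) (at u)"
    "\<And>X f. elementary_on X f \<Longrightarrow> (\<And>x. x \<in> X \<Longrightarrow> \<bar>f x\<bar> \<le> 1) \<Longrightarrow> elementary_on X (\<lambda>x. S (f x))"
    using inverse_quadratic_elementary_antiderivative[of "I\<^sub>3" "I\<^sub>2 - I\<^sub>3"] inertia by auto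
  obtain S' where S': "\<And>u. \<bar>u\<bar> \<le> 1 \<Longrightarrow> (S' has_real_derivative 1 / (I\<^sub>2 + (I\<^sub>3 - I\<^sub>2) * u\<^sup>2)) (at u)"
    "\<And>X f. elementary_on X f \<Longrightarrow> (\<And>x. x \<in> X \<Longrightarrow> \<bar>f x\<bar> \<le> 1) \<Longrightarrow> elementary_on X (\<lambda>x. S' (f x))"
    using inverse_quadratic_elementary_antiderivative[of "I\<^sub>2" "I\<^sub>3 - I\<^sub>2"] inertia by auto
  show thesis
  proof (rule that[of "\<lambda>\<theta>. m * (d * S (sin \<theta>) - b * S' (cos \<theta>))"])
    fix \<theta>
    have "R \<theta> = I\<^sub>3 + (I\<^sub>2 - I\<^sub>3) * (sin \<theta>)\<^sup>2" "R \<theta> = I\<^sub>2 + (I\<^sub>3 - I\<^sub>2) * (cos \<theta>)\<^sup>2"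
      unfolding R_def using assms sin_cos_squared_add[of \<theta>] by algebra+
    then have "((\<lambda>\<theta>. S (sin \<theta>)) has_real_derivative 1 / R \<theta> * cos \<theta>) (at \<theta>)"
      "((\<lambda>\<theta>. S' (cos \<theta>)) has_real_derivative 1 / R \<theta> * - sin \<theta>) (at \<theta>)"
      using DERIV_chain2[OF S(1) DERIV_sin, of \<theta>] DERIV_chain2[OF S'(1) DERIV_cos, of \<theta>] by simp_all
    then show "((\<lambda>\<theta>. m * (d * S (sin \<theta>) - b * S' (cos \<theta>))) has_real_derivative
        m * height \<theta> / R \<theta>) (at \<theta>)"
      by (auto intro!: derivative_eq_intros simp: height_def add_divide_distrib algebra_simps)
  qed (intro elementary_intros S(2) S'(2); simp)
qed

lemma R_pos: "R \<theta> > 0"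
  using planar_inertia_pos[of \<theta>] m by (simp add: R_def add_pos_nonneg)

text \<open>For \<open>a = 0\<close> the conditions can be integrated one after the other, each step
  leaving one constant: first for \<gamma>, then for \<open>\<alpha> + offset * \<beta>\<close>,
  then for \<beta>.\<close>

lemma elementary_if_central:
  assumes a: "a = 0" and "linear_constant_of_motion m g inert com \<alpha> \<beta> \<gamma>"
  shows "elementary_on lean_range \<alpha>" "elementary_on lean_range \<beta>" "elementary_on lean_range \<gamma>"
proof -
  obtain \<alpha>' \<beta>' \<gamma>' where
    der: "\<And>\<theta>. \<theta> \<in> lean_range \<Longrightarrow> (\<alpha> has_real_derivative \<alpha>' \<theta>) (at \<theta>)"
      "\<And>\<theta>. \<theta> \<in> lean_range \<Longrightarrow> (\<beta> has_real_derivative \<beta>' \<theta>) (at \<theta>)"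
      "\<And>\<theta>. \<theta> \<in> lean_range \<Longrightarrow> (\<gamma> has_real_derivative \<gamma>' \<theta>) (at \<theta>)"
    and z: "\<And>\<theta> w1 w2 v. \<theta> \<in> lean_range \<Longrightarrow>
        drift (\<alpha> \<theta>) (\<alpha>' \<theta>) (\<beta> \<theta>) (\<beta>' \<theta>) (\<gamma> \<theta>) (\<gamma>' \<theta>) \<theta> w1 w2 v = 0"
    by (rule linear_constant_of_motionE[OF assms(2)]) blast
  note q = drift_zero_coefficients[OF z]
  have "(\<gamma> has_real_derivative 0) (at \<theta>)" if "\<theta> \<in> lean_range" for \<theta>
    using der(3)[OF that] q(1)[OF that] J_pos by (simp add: a)
  then obtain c where "\<And>\<theta>. \<theta> \<in> lean_range \<Longrightarrow> \<gamma> \<theta> = c"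
    using has_real_derivative_zero_lean_range by blast
  then show "elementary_on lean_range \<gamma>"
    by (rule elementary_on.cong[OF elementary_on.const])
  have "((\<lambda>\<theta>. \<alpha> \<theta> + offset \<theta> * \<beta> \<theta>) has_real_derivative 0) (at \<theta>)" if "\<theta> \<in> lean_range" for \<theta>
    using der[OF that] q(4)[OF that] by (auto intro!: derivative_eq_intros simp: algebra_simps)
  then obtain k where k: "\<And>\<theta>. \<theta> \<in> lean_range \<Longrightarrow> \<alpha> \<theta> + offset \<theta> * \<beta> \<theta> = k"
    using has_real_derivative_zero_lean_range by blast
  obtain B where B: "\<And>\<theta>. (B has_real_derivative m * height \<theta> / R \<theta>) (at \<theta>)" "\<And>X. elementary_on X B"
    by (rule height_antiderivative[OF a]) blast
  \<comment> \<open>Subtracting \<open>m * offset \<theta>\<close> times the fourth condition from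
    the third eliminates \<open>\<alpha>'\<close>, and \<alpha>, \<beta> remain only in the
    combination equal to \<open>k\<close>.\<close>
  have "\<beta>' \<theta> = k * (m * height \<theta> / R \<theta>)" if "\<theta> \<in> lean_range" for \<theta>
  proof -
    have "R \<theta> * \<beta>' \<theta> = m * height \<theta> * k"
      using q(3)[OF that] q(4)[OF that] k[OF that] a by algebra
    then show ?thesis
      using R_pos[of \<theta>] by (simp add: field_simps)
  qed
  then have "((\<lambda>\<theta>. \<beta> \<theta> - k * B \<theta>) has_real_derivative 0) (at \<theta>)" if "\<theta> \<in> lean_range" for \<theta>
    using der(2)[OF that] B(1)[of \<theta>] that by (auto intro!: derivative_eq_intros)
  then obtain c where c: "\<And>\<theta>. \<theta> \<in> lean_range \<Longrightarrow> \<beta> \<theta> - k * B \<theta> = c"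
    using has_real_derivative_zero_lean_range by blast
  show \<beta>: "elementary_on lean_range \<beta>"
  proof (rule elementary_on.cong)
    show "elementary_on lean_range (\<lambda>\<theta>. c + k * B \<theta>)"
      by (intro elementary_intros B(2))
  qed (use c in \<open>auto simp: algebra_simps\<close>)
  show "elementary_on lean_range \<alpha>"
  proof (rule elementary_on.cong)
    show "elementary_on lean_range (\<lambda>\<theta>. k - offset \<theta> * \<beta> \<theta>)"
      by (intro elementary_intros elementary_offset \<beta>)
  qed (use k in \<open>auto simp: algebra_simps\<close>)
qed

text \<open>The witnesses have \<gamma> = 0 and are the solutions with \<open>k = 0\<close>, \<beta>
  = 1 and with \<open>k = 1\<close>, \<beta> = \<open>B\<close>. The first constant of motion equals
  \<open>R \<theta> * w2\<close>, the vertical angular momentum about the center of mass.\<close>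

lemma integrable_if_central:
  assumes a: "a = 0"
  shows "integrable_linear_in_momenta m g inert com"
proof -
  obtain B where B: "\<And>\<theta>. (B has_real_derivative m * height \<theta> / R \<theta>) (at \<theta>)"
    by (rule height_antiderivative[OF a]) blast
  have contB: "continuous_on lean_range B"
    by (intro continuous_at_imp_continuous_on ballI DERIV_isCont[OF B])
  have contR: "continuous_on lean_range (\<lambda>\<theta>. m * height \<theta> / R \<theta>)"
    using R_pos unfolding R_def by (intro continuous_intros continuous_on_height) (metis less_irrefl)
  have "linear_constant_of_motion m g inert com (\<lambda>\<theta>. - offset \<theta>) (\<lambda>\<theta>. 1) (\<lambda>\<theta>. 0)"
  proof (rule linear_constant_of_motionI)
    show "((\<lambda>\<theta>. - offset \<theta>) has_real_derivative - height \<theta>) (at \<theta>)" for \<theta>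
      by (auto intro!: derivative_eq_intros)
    show "drift (- offset \<theta>) (- height \<theta>) 1 0 0 0 \<theta> w1 w2 v = 0" for \<theta> w1 w2 v
      unfolding drift_eq by (simp add: a)
  qed (intro continuous_intros continuous_on_height derivative_intros)+
  moreover have "linear_constant_of_motion m g inert com (\<lambda>\<theta>. 1 - offset \<theta> * B \<theta>) B (\<lambda>\<theta>. 0)"
  proof (rule linear_constant_of_motionI)
    let ?B' = "\<lambda>\<theta>. m * height \<theta> / R \<theta>"
    let ?\<alpha>' = "\<lambda>\<theta>. - (height \<theta> * B \<theta> + offset \<theta> * ?B' \<theta>)"
    show "((\<lambda>\<theta>. 1 - offset \<theta> * B \<theta>) has_real_derivative ?\<alpha>' \<theta>) (at \<theta>)" for \<theta>
      by (auto intro!: derivative_eq_intros B)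
    show "continuous_on lean_range ?\<alpha>'"
      by (intro continuous_intros continuous_on_height continuous_on_offset contB contR)
    fix \<theta> w1 w2 v
    have "R \<theta> * ?B' \<theta> = m * height \<theta>"
      using R_pos[of \<theta>] by simp
    then have "m * offset \<theta> * ?\<alpha>' \<theta> + (R \<theta> + m * (offset \<theta>)\<^sup>2) * ?B' \<theta>
        - m * height \<theta> * (1 - offset \<theta> * B \<theta>) = 0"
      by algebra
    then show "drift (1 - offset \<theta> * B \<theta>) (?\<alpha>' \<theta>) (B \<theta>) (?B' \<theta>) 0 0 \<theta> w1 w2 v = 0"
      unfolding drift_eq by (simp add: a algebra_simps)
  qed (use B contR in auto)
  moreover have "independent_triples (\<lambda>\<theta>. - offset \<theta>) (\<lambda>\<theta>. 1) (\<lambda>\<theta>. 0) (\<lambda>\<theta>. 1 - offset \<theta> * B \<theta>) B (\<lambda>\<theta>. 0)"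
    unfolding independent_triples_def
  proof (intro allI impI)
    fix x y :: real
    assume *: "\<forall>\<theta>\<in>lean_range. x * - offset \<theta> + y * (1 - offset \<theta> * B \<theta>) = 0 \<and> x * 1 + y * B \<theta> = 0 \<and> x * 0 + y * 0 = 0"
    \<comment> \<open>One angle suffices: the two pairs of values of \<alpha> and \<beta> at 0 have
      determinant -1, whatever \<open>offset 0\<close> and \<open>B 0\<close> are.\<close>
    have "0 \<in> lean_range" by (simp add: lean_range_def)
    with * have "x * - offset 0 + y * (1 - offset 0 * B 0) = 0" "x + y * B 0 = 0"
      by auto
    moreover from this have "y = 0" by algebra
    ultimately show "x = 0 \<and> y = 0" by simp
  qed
  ultimately show ?thesis
    unfolding integrable_linear_in_momenta_def by blast
qed

text \<open>As \<open>a \<noteq> 0\<close>, the conditions for \<open>w2 * v\<close> and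
  \<open>w2\<^sup>2\<close> express \<beta> and \<alpha> through \<gamma>. Differentiating the
  former and inserting \<open>\<beta>'\<close> into the condition for \<open>w1\<^sup>2\<close>
  gives a homogeneous linear equation of first order for \<gamma>.\<close>

lemma noncentral_coefficients:
  assumes a: "a \<noteq> 0" and "linear_constant_of_motion m g inert com \<alpha> \<beta> \<gamma>"
  obtains k where "\<And>\<theta>. \<theta> \<in> lean_range \<Longrightarrow> \<gamma> \<theta> = k / sqrt (J - m * (height \<theta>)\<^sup>2)"
    "\<And>\<theta>. \<theta> \<in> lean_range \<Longrightarrow> \<beta> \<theta> = \<gamma> \<theta> * (height \<theta> / a)"
    "\<And>\<theta>. \<theta> \<in> lean_range \<Longrightarrow> \<alpha> \<theta> =
       \<gamma> \<theta> * (((I\<^sub>3 - I\<^sub>2) * sin \<theta> * cos \<theta> - m * offset \<theta> * height \<theta>) / (m * a))"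
proof -
  obtain \<alpha>' \<beta>' \<gamma>' where
    der: "\<And>\<theta>. \<theta> \<in> lean_range \<Longrightarrow> (\<alpha> has_real_derivative \<alpha>' \<theta>) (at \<theta>)"
      "\<And>\<theta>. \<theta> \<in> lean_range \<Longrightarrow> (\<beta> has_real_derivative \<beta>' \<theta>) (at \<theta>)"
      "\<And>\<theta>. \<theta> \<in> lean_range \<Longrightarrow> (\<gamma> has_real_derivative \<gamma>' \<theta>) (at \<theta>)"
    and z: "\<And>\<theta> w1 w2 v. \<theta> \<in> lean_range \<Longrightarrow>
        drift (\<alpha> \<theta>) (\<alpha>' \<theta>) (\<beta> \<theta>) (\<beta>' \<theta>) (\<gamma> \<theta>) (\<gamma>' \<theta>) \<theta> w1 w2 v = 0"
    by (rule linear_constant_of_motionE[OF assms(2)]) blast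
  note q = drift_zero_coefficients[OF z]
  let ?X = "\<lambda>\<theta>. J - m * (height \<theta>)\<^sup>2"
  have "((\<lambda>\<theta>. \<gamma> \<theta> * sqrt (?X \<theta>)) has_real_derivative 0) (at \<theta>)" if \<theta>: "\<theta> \<in> lean_range" for \<theta>
  proof -
    have "((\<lambda>\<theta>. height \<theta> * \<gamma> \<theta>) has_real_derivative height \<theta> * \<gamma>' \<theta> - offset \<theta> * \<gamma> \<theta>) (at \<theta>)"
      using der(3)[OF \<theta>] by (auto intro!: derivative_eq_intros)
    \<comment> \<open>The functions \<open>height * \<gamma>\<close> and \<open>a * \<beta>\<close>
      are known to agree on \<open>lean_range\<close>, whose openness lets the derivative carry
      over.\<close>
    moreover have "((\<lambda>\<theta>. height \<theta> * \<gamma> \<theta>) has_real_derivative a * \<beta>' \<theta>) (at \<theta>)"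
    proof (rule has_field_derivative_transform_within_open[OF _ _ \<theta>])
      show "((\<lambda>\<theta>. a * \<beta> \<theta>) has_real_derivative a * \<beta>' \<theta>) (at \<theta>)"
        using der(2)[OF \<theta>] by (auto intro!: derivative_eq_intros)
    qed (use q(5) in \<open>auto simp: lean_range_def\<close>)
    ultimately have "a * \<beta>' \<theta> = height \<theta> * \<gamma>' \<theta> - offset \<theta> * \<gamma> \<theta>"
      using DERIV_unique by blast
    with q(1)[OF \<theta>] have ode: "?X \<theta> * \<gamma>' \<theta> + m * height \<theta> * offset \<theta> * \<gamma> \<theta> = 0"
      by algebra
    have pos: "?X \<theta> > 0" by (rule J_gt_height)
    \<comment> \<open>The square root is an integrating factor, since the derivative of
      \<open>?X\<close> is \<open>2 * m * height \<theta> * offset \<theta>\<close>.\<close>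
    have "((\<lambda>\<theta>. \<gamma> \<theta> * sqrt (?X \<theta>)) has_real_derivative
        (?X \<theta> * \<gamma>' \<theta> + m * height \<theta> * offset \<theta> * \<gamma> \<theta>) / sqrt (?X \<theta>)) (at \<theta>)"
      using der(3)[OF \<theta>] pos
      by (auto intro!: derivative_eq_intros simp: field_simps power2_eq_square real_sqrt_mult_self)
    then show ?thesis unfolding ode by simp
  qed
  then obtain k where k: "\<And>\<theta>. \<theta> \<in> lean_range \<Longrightarrow> \<gamma> \<theta> * sqrt (?X \<theta>) = k"
    using has_real_derivative_zero_lean_range by blast
  show thesis
  proof
    show "\<gamma> \<theta> = k / sqrt (?X \<theta>)" if "\<theta> \<in> lean_range" for \<theta>
      using k[OF that] J_gt_height[of \<theta>] by (simp add: field_simps)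
    show "\<beta> \<theta> = \<gamma> \<theta> * (height \<theta> / a)" if "\<theta> \<in> lean_range" for \<theta>
      using q(5)[OF that] a by (simp add: field_simps)
    show "\<alpha> \<theta> = \<gamma> \<theta> * (((I\<^sub>3 - I\<^sub>2) * sin \<theta> * cos \<theta> - m * offset \<theta> * height \<theta>) / (m * a))"
      if "\<theta> \<in> lean_range" for \<theta>
      using q(2)[OF that] a m by (simp add: field_simps)
  qed
qed

text \<open>Nothing is claimed about the existence of nonzero constants of motion: any that exist
  have the explicit form just derived.\<close>

lemma elementary_if_noncentral:
  assumes a: "a \<noteq> 0" and "linear_constant_of_motion m g inert com \<alpha> \<beta> \<gamma>"
  shows "elementary_on lean_range \<alpha>" "elementary_on lean_range \<beta>" "elementary_on lean_range \<gamma>"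
proof -
  obtain k where k: "\<And>\<theta>. \<theta> \<in> lean_range \<Longrightarrow> \<gamma> \<theta> = k / sqrt (J - m * (height \<theta>)\<^sup>2)"
    "\<And>\<theta>. \<theta> \<in> lean_range \<Longrightarrow> \<beta> \<theta> = \<gamma> \<theta> * (height \<theta> / a)"
    "\<And>\<theta>. \<theta> \<in> lean_range \<Longrightarrow> \<alpha> \<theta> =
       \<gamma> \<theta> * (((I\<^sub>3 - I\<^sub>2) * sin \<theta> * cos \<theta> - m * offset \<theta> * height \<theta>) / (m * a))"
    by (rule noncentral_coefficients[OF assms]) blast
  have "sqrt (J - m * (height \<theta>)\<^sup>2) \<noteq> 0" for \<theta>
    using J_gt_height[of \<theta>] by simp
  then show \<gamma>: "elementary_on lean_range \<gamma>"
    by (intro elementary_on.cong[OF _ k(1)] elementary_intros elementary_height J_gt_height)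
  show "elementary_on lean_range \<beta>"
    using a by (intro elementary_on.cong[OF _ k(2)] elementary_intros elementary_height \<gamma>)
  show "elementary_on lean_range \<alpha>"
    using a m by (intro elementary_on.cong[OF _ k(3)] elementary_intros elementary_height
        elementary_offset \<gamma>) auto
qed

lemma not_integrable_if_noncentral:
  assumes a: "a \<noteq> 0"
  shows "\<not> integrable_linear_in_momenta m g inert com"
proof
  assume "integrable_linear_in_momenta m g inert com"
  then obtain \<alpha> \<beta> \<gamma> \<alpha>' \<beta>' \<gamma>' where
    c: "linear_constant_of_motion m g inert com \<alpha> \<beta> \<gamma>" "linear_constant_of_motion m g inert com \<alpha>' \<beta>' \<gamma>'"
    and ind: "independent_triples \<alpha> \<beta> \<gamma> \<alpha>' \<beta>' \<gamma>'"
    unfolding integrable_linear_in_momenta_def by blast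
  define \<gamma>0 \<beta>0 \<alpha>0 where "\<gamma>0 \<theta> = 1 / sqrt (J - m * (height \<theta>)\<^sup>2)" and "\<beta>0 \<theta> = height \<theta> / a"
    and "\<alpha>0 \<theta> = ((I\<^sub>3 - I\<^sub>2) * sin \<theta> * cos \<theta> - m * offset \<theta> * height \<theta>) / (m * a)" for \<theta>
  obtain k where k: "\<And>\<theta>. \<theta> \<in> lean_range \<Longrightarrow> \<gamma> \<theta> = k * \<gamma>0 \<theta>"
    "\<And>\<theta>. \<theta> \<in> lean_range \<Longrightarrow> \<beta> \<theta> = \<gamma> \<theta> * \<beta>0 \<theta>" "\<And>\<theta>. \<theta> \<in> lean_range \<Longrightarrow> \<alpha> \<theta> = \<gamma> \<theta> * \<alpha>0 \<theta>"
    using noncentral_coefficients[OF a c(1)] by (auto simp: \<gamma>0_def \<beta>0_def \<alpha>0_def)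
  obtain k' where k': "\<And>\<theta>. \<theta> \<in> lean_range \<Longrightarrow> \<gamma>' \<theta> = k' * \<gamma>0 \<theta>"
    "\<And>\<theta>. \<theta> \<in> lean_range \<Longrightarrow> \<beta>' \<theta> = \<gamma>' \<theta> * \<beta>0 \<theta>" "\<And>\<theta>. \<theta> \<in> lean_range \<Longrightarrow> \<alpha>' \<theta> = \<gamma>' \<theta> * \<alpha>0 \<theta>"
    using noncentral_coefficients[OF a c(2)] by (auto simp: \<gamma>0_def \<beta>0_def \<alpha>0_def)
  \<comment> \<open>Both triples are multiples of one fixed triple, with factors \<open>k\<close>
    and \<open>k'\<close>, so cross multiplication yields a linear relation.\<close>
  have "\<forall>\<theta>\<in>lean_range. k' * \<alpha> \<theta> + (- k) * \<alpha>' \<theta> = 0 \<and> k' * \<beta> \<theta> + (- k) * \<beta>' \<theta> = 0 \<and>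
      k' * \<gamma> \<theta> + (- k) * \<gamma>' \<theta> = 0"
    using k k' by simp
  then have "k' = 0 \<and> - k = 0"
    using ind unfolding independent_triples_def by blast
  \<comment> \<open>Now \<open>k = 0\<close> makes the first triple zero, which gives the relation
    with coefficients 1 and 0 and contradicts independence.\<close>
  then have "\<forall>\<theta>\<in>lean_range. 1 * \<alpha> \<theta> + 0 * \<alpha>' \<theta> = 0 \<and> 1 * \<beta> \<theta> + 0 * \<beta>' \<theta> = 0 \<and>
      1 * \<gamma> \<theta> + 0 * \<gamma>' \<theta> = 0"
    using k by simp
  then have "(1::real) = 0 \<and> (0::real) = 0"
    using ind unfolding independent_triples_def by blast
  then show False by simp
qed

end

theorem theorem1:
  fixes m g I\<^sub>1 I\<^sub>2 I\<^sub>3 A\<^sub>1 A\<^sub>2 A\<^sub>3 :: real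
    and \<I> :: "real^3^3" and A :: "real^3"
  assumes "m > 0" and "g \<ge> 0"
    and "I\<^sub>1 > 0" and "I\<^sub>2 > 0" and "I\<^sub>3 > 0"
    and "\<I> = vector [vector [I\<^sub>1, 0, 0], vector [0, I\<^sub>2, 0], vector [0, 0, I\<^sub>3]]"
    and "A = vector [A\<^sub>1, A\<^sub>2, A\<^sub>3]"
  shows "(integrable_linear_in_momenta m g \<I> A \<longleftrightarrow> A\<^sub>1 = 0) \<and>
    (\<forall>\<alpha> \<beta> \<gamma>. linear_constant_of_motion m g \<I> A \<alpha> \<beta> \<gamma> \<longrightarrow>
       elementary_on {-pi/2<..<pi/2} \<alpha> \<and>
       elementary_on {-pi/2<..<pi/2} \<beta> \<and>
       elementary_on {-pi/2<..<pi/2} \<gamma>)"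
proof -
  interpret skater m g I\<^sub>1 I\<^sub>2 I\<^sub>3 A\<^sub>1 A\<^sub>2 A\<^sub>3
    using assms by unfold_locales
  have eqs: "\<I> = inert" "A = com"
    unfolding inert_def com_def using assms by simp_all
  show ?thesis
    unfolding eqs lean_range_def[symmetric]
    using integrable_if_central not_integrable_if_noncentral elementary_if_central
      elementary_if_noncentral by metis
qed

end
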